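(* In the semidirect product $\mathcal S$: (a) the algebra $J_q^0(n)$ is isomorphic to the subalgebra generated by the elements $J_{i,j}=Z_{i,j}L(\lambda_\beta)^{-(i+j)}L(\lambda_{\mu_i})^{-1}L(\lambda_{\nu_j})^{-1}$, $i,j=1,\dots,n$; (b) the algebra $J_q^z(n)$ is isomorphic to the subalgebra generated by the elements $M_{i,j}=Z_{i,j}L(\lambda_{\mu_i})^{-1}L(\lambda_{\nu_j})^{-1}$, $i,j=1,\dots,n$; (c) the algebra $J_q^n(n)$ is isomorphic to the subalgebra generated by the elements $N_{i,j}=Z_{i,j}L(\lambda_\beta)^{-i+j}L(\lambda_{\mu_i})^{-1}L(\lambda_{\nu_j})$, $i,j=1,\dots,n$.
   Context: Let $q\in\mathbb C^*$, $q^2\ne1$. $M_q(n)$ is the $\mathbb C$-algebra generated by $Z_{i,j}$ ($1\le i,j\le n$) with defining relations $Z_{i,j}Z_{i,k}=qZ_{i,k}Z_{i,j}$ if $j<k$; $Z_{i,j}Z_{k,j}=qZ_{k,j}Z_{i,j}$ if $i<k$; $Z_{i,j}Z_{s,t}=Z_{s,t}Z_{i,j}$ if $i<s$, $t<j$; $Z_{i,j}Z_{s,t}=Z_{s,t}Z_{i,j}+(q-q^{-1})Z_{i,t}Z_{s,j}$ if $i<s$, $j<t$. $\mathcal S$ is the semidirect (smash) product of the Laurent polynomial ring in the commuting invertible variables $L(\lambda_\beta)$, $L(\lambda_{\mu_k})$, $L(\lambda_{\nu_k})$ ($1\le k\le n-1$) with $M_q(n)$: as a vector space it is $M_q(n)$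 tensor the Laurent polynomial ring, both factors are subalgebras, and $L(\lambda_\beta)Z_{i,j}=qZ_{i,j}L(\lambda_\beta)$, $L(\lambda_{\mu_k})Z_{i,j}=q^{[k<i]}Z_{i,j}L(\lambda_{\mu_k})$, $L(\lambda_{\nu_k})Z_{i,j}=q^{[k<j]}Z_{i,j}L(\lambda_{\nu_k})$, where $[\cdot]$ is $1$ if the condition holds and $0$ otherwise. (It is a subalgebra of $\mathcal U_q(A_{2n-1})$.) By convention $L(\lambda_{\mu_n})=L(\lambda_{\nu_n})=1$. The following algebras are given by generators indexed by $1\le i,j\le n$ and relations. $J^0_q(n)$: $J_{i,j}J_{s,t}=q^{s+t-i-j}J_{s,t}J_{i,j}$ if $(s-i)(t-j)\le0$; $q^{1-t+j}J_{i,j}J_{s,t}=q^{s-i-1}J_{s,t}J_{i,j}+(q-q^{-1})J_{i,t}J_{s,j}$ if $s>i$ and $t>j$. $J^z_q(n)$: $M_{i,j}M_{s,t}=M_{s,t}M_{i,j}$ if $(s-i)(t-j)\le0$; $qM_{i,j}M_{s,t}=q^{-1}M_{s,t}M_{i,j}+(q-q^{-1})M_{i,t}M_{s,j}$ if $i<s$ and $j<t$. $J^n_q(n)$: $N_{i,j}N_{s,t}=q^{s-t-i+j-2}N_{s,t}N_{i,j}$ if $s\ge i$ and $t<j$; $N_{i,j}N_{s,t}=q^{s-i}N_{s,t}N_{i,j}$ if $s>i$ and $t=j$; $q^{t-j-1}N_{i,j}N_{s,t}=q^{s-i-1}N_{s,t}N_{i,j}+(q-q^{-1})N_{i,t}N_{s,j}$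 if $s>i$ and $t>j$. *)

theory Defs
  imports
    Complex_Main
    "HOL-Library.Poly_Mapping"
    "HOL-Algebra.QuotRing"
    "HOL-Algebra.Subrings"
    "HOL-Algebra.Module"
begin

section \<open>Associative unital complex algebras\<close>

text \<open>
  A complex algebra is a (not necessarily commutative) HOL-Algebra ring together with the
  scalar multiplication field of the record \<^type>\<open>module\<close>, whose scalar type is \<^typ>\<open>complex\<close>.
\<close>

definition alg_iso :: "(complex, 'a) module \<Rightarrow> (complex, 'b) module \<Rightarrow> ('a \<Rightarrow> 'b) set" where
  "alg_iso A B = {h \<in> ring_iso A B.
     \<forall>c. \<forall>x \<in> carrier A. h (c \<odot>\<^bsub>A\<^esub> x) = c \<odot>\<^bsub>B\<^esub> h x}"

definition is_subalg :: "'a set \<Rightarrow> (complex, 'a) module \<Rightarrow> bool" where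
  "is_subalg V A \<longleftrightarrow> subring V A \<and> (\<forall>c. \<forall>v \<in> V. c \<odot>\<^bsub>A\<^esub> v \<in> V)"

definition subalg_gen :: "(complex, 'a) module \<Rightarrow> 'a set \<Rightarrow> (complex, 'a) module" where
  "subalg_gen A X = A\<lparr>carrier := \<Inter>{V. is_subalg V A \<and> X \<subseteq> V}\<rparr>"


section \<open>Free algebras and presentations\<close>

text \<open>
  Words form a monoid under concatenation. With this instance \<open>'x list \<Rightarrow>\<^sub>0 complex\<close>,
  with its convolution product, is the free complex algebra on \<open>'x\<close>.
\<close>

instantiation list :: (type) monoid_add
begin
definition zero_list_def: "(0 :: 'a list) = []"
definition plus_list_def: "(xs :: 'a list) + ys = xs @ ys"
instance by standard (simp_all add: zero_list_def plus_list_def)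
end

type_synonym 'x ncpoly = "'x list \<Rightarrow>\<^sub>0 complex"

definition nc_scale :: "complex \<Rightarrow> 'x ncpoly \<Rightarrow> 'x ncpoly"  (infixr \<open>*\<^sub>C\<close> 75) where
  "c *\<^sub>C f = Poly_Mapping.map ((*) c) f"

definition gen :: "'x \<Rightarrow> 'x ncpoly" where
  "gen x = Poly_Mapping.single [x] 1"

definition free_alg :: "'x set \<Rightarrow> (complex, 'x ncpoly) module" where
  "free_alg X = \<lparr>carrier = {f. \<forall>w \<in> Poly_Mapping.keys f. set w \<subseteq> X},
     mult = (*), one = 1, zero = 0, add = (+), smult = nc_scale\<rparr>"

text \<open>The relations are given as a set of pairs (left-hand side, right-hand side).\<close>

definition rel_ideal :: "'x set \<Rightarrow> ('x ncpoly \<times> 'x ncpoly) set \<Rightarrow> 'x ncpoly set" where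
  "rel_ideal X R = Idl\<^bsub>free_alg X\<^esub> {l - r | l r. (l, r) \<in> R}"

definition presented_alg ::
    "'x set \<Rightarrow> ('x ncpoly \<times> 'x ncpoly) set \<Rightarrow> (complex, 'x ncpoly set) module" where
  "presented_alg X R =
     (let F = free_alg X; I = rel_ideal X R; Q = F Quot I
      in \<lparr>carrier = carrier Q, mult = mult Q, one = one Q, zero = zero Q, add = add Q,
          smult = (\<lambda>c C. I <+>\<^bsub>F\<^esub> ((\<lambda>f. c *\<^sub>C f) ` C))\<rparr>)"

definition presented_gen ::
    "'x set \<Rightarrow> ('x ncpoly \<times> 'x ncpoly) set \<Rightarrow> 'x \<Rightarrow> 'x ncpoly set" where
  "presented_gen X R x = rel_ideal X R +>\<^bsub>free_alg X\<^esub> gen x"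


section \<open>The quantum matrix algebras\<close>

definition idx :: "nat \<Rightarrow> (nat \<times> nat) set" where
  "idx n = {1..n} \<times> {1..n}"

abbreviation gx :: "nat \<Rightarrow> nat \<Rightarrow> (nat \<times> nat) ncpoly" where
  "gx i j \<equiv> gen (i, j)"

definition Mq_rels :: "complex \<Rightarrow> nat \<Rightarrow> ((nat \<times> nat) ncpoly \<times> (nat \<times> nat) ncpoly) set" where
  "Mq_rels q n =
     {(gx i j * gx i k, q *\<^sub>C (gx i k * gx i j)) | i j k.
        i \<in> {1..n} \<and> j \<in> {1..n} \<and> k \<in> {1..n} \<and> j < k} \<union>
     {(gx i j * gx k j, q *\<^sub>C (gx k j * gx i j)) | i j k.
        i \<in> {1..n} \<and> j \<in> {1..n} \<and> k \<in> {1..n} \<and> i < k} \<union>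
     {(gx i j * gx s t, gx s t * gx i j) | i j s t.
        (i, j) \<in> idx n \<and> (s, t) \<in> idx n \<and> i < s \<and> t < j} \<union>
     {(gx i j * gx s t, gx s t * gx i j + (q - inverse q) *\<^sub>C (gx i t * gx s j)) | i j s t.
        (i, j) \<in> idx n \<and> (s, t) \<in> idx n \<and> i < s \<and> j < t}"

definition J0_rels :: "complex \<Rightarrow> nat \<Rightarrow> ((nat \<times> nat) ncpoly \<times> (nat \<times> nat) ncpoly) set" where
  "J0_rels q n =
     {(gx i j * gx s t, (q powi (int s + int t - int i - int j)) *\<^sub>C (gx s t * gx i j)) | i j s t.
        (i, j) \<in> idx n \<and> (s, t) \<in> idx n \<and> (int s - int i) * (int t - int j) \<le> 0} \<union>
     {((q powi (1 - int t + int j)) *\<^sub>C (gx i j * gx s t),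
       (q powi (int s - int i - 1)) *\<^sub>C (gx s t * gx i j)
         + (q - inverse q) *\<^sub>C (gx i t * gx s j)) | i j s t.
        (i, j) \<in> idx n \<and> (s, t) \<in> idx n \<and> s > i \<and> t > j}"

definition Jz_rels :: "complex \<Rightarrow> nat \<Rightarrow> ((nat \<times> nat) ncpoly \<times> (nat \<times> nat) ncpoly) set" where
  "Jz_rels q n =
     {(gx i j * gx s t, gx s t * gx i j) | i j s t.
        (i, j) \<in> idx n \<and> (s, t) \<in> idx n \<and> (int s - int i) * (int t - int j) \<le> 0} \<union>
     {(q *\<^sub>C (gx i j * gx s t),
       inverse q *\<^sub>C (gx s t * gx i j) + (q - inverse q) *\<^sub>C (gx i t * gx s j)) | i j s t.
        (i, j) \<in> idx n \<and> (s, t) \<in> idx n \<and> i < s \<and> j < t}"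

definition Jn_rels :: "complex \<Rightarrow> nat \<Rightarrow> ((nat \<times> nat) ncpoly \<times> (nat \<times> nat) ncpoly) set" where
  "Jn_rels q n =
     {(gx i j * gx s t, (q powi (int s - int t - int i + int j - 2)) *\<^sub>C (gx s t * gx i j)) | i j s t.
        (i, j) \<in> idx n \<and> (s, t) \<in> idx n \<and> s \<ge> i \<and> t < j} \<union>
     {(gx i j * gx s t, (q powi (int s - int i)) *\<^sub>C (gx s t * gx i j)) | i j s t.
        (i, j) \<in> idx n \<and> (s, t) \<in> idx n \<and> s > i \<and> t = j} \<union>
     {((q powi (int t - int j - 1)) *\<^sub>C (gx i j * gx s t),
       (q powi (int s - int i - 1)) *\<^sub>C (gx s t * gx i j)
         + (q - inverse q) *\<^sub>C (gx i t * gx s j)) | i j s t.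
        (i, j) \<in> idx n \<and> (s, t) \<in> idx n \<and> s > i \<and> t > j}"

definition Mq :: "complex \<Rightarrow> nat \<Rightarrow> (complex, (nat \<times> nat) ncpoly set) module" where
  "Mq q n = presented_alg (idx n) (Mq_rels q n)"

definition J0 :: "complex \<Rightarrow> nat \<Rightarrow> (complex, (nat \<times> nat) ncpoly set) module" where
  "J0 q n = presented_alg (idx n) (J0_rels q n)"

definition Jz :: "complex \<Rightarrow> nat \<Rightarrow> (complex, (nat \<times> nat) ncpoly set) module" where
  "Jz q n = presented_alg (idx n) (Jz_rels q n)"

definition Jn :: "complex \<Rightarrow> nat \<Rightarrow> (complex, (nat \<times> nat) ncpoly set) module" where
  "Jn q n = presented_alg (idx n) (Jn_rels q n)"


section \<open>Smash products with a group algebra\<close>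

text \<open>
  Let an additive group \<open>G\<close> act on the algebra \<open>A\<close> by automorphisms. The smash product of \<open>A\<close>
  with the group algebra of \<open>G\<close> has \<open>A \<otimes> \<complex>[G]\<close> as underlying vector space; the element
  \<open>\<Sum>a. x\<^sub>a \<otimes> L\<^sup>a\<close> is encoded as the finitely supported function \<open>a \<mapsto> x\<^sub>a\<close>. The product is
  determined by \<open>(x \<otimes> L\<^sup>a) (y \<otimes> L\<^sup>b) = x (act a y) \<otimes> L\<^sup>a\<^sup>+\<^sup>b\<close>.
\<close>

definition smash ::
    "(complex, 'm) module \<Rightarrow> ('e::ab_group_add) set \<Rightarrow> ('e \<Rightarrow> 'm \<Rightarrow> 'm) \<Rightarrow> (complex, 'e \<Rightarrow> 'm) module"
  where
  "smash A G act =
     \<lparr>carrier = {f. (\<forall>a. f a \<in> carrier A) \<and> (\<forall>a. a \<notin> G \<longrightarrow> f a = \<zero>\<^bsub>A\<^esub>)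
                  \<and> finite {a. f a \<noteq> \<zero>\<^bsub>A\<^esub>}},
      mult = (\<lambda>f h c. \<Oplus>\<^bsub>A\<^esub>a \<in> {a. f a \<noteq> \<zero>\<^bsub>A\<^esub>}. f a \<otimes>\<^bsub>A\<^esub> act a (h (c - a))),
      one = (\<lambda>a. if a = 0 then \<one>\<^bsub>A\<^esub> else \<zero>\<^bsub>A\<^esub>),
      zero = (\<lambda>a. \<zero>\<^bsub>A\<^esub>),
      add = (\<lambda>f h a. f a \<oplus>\<^bsub>A\<^esub> h a),
      smult = (\<lambda>c f a. c \<odot>\<^bsub>A\<^esub> f a)\<rparr>"

definition smash_tensor :: "(complex, 'm) module \<Rightarrow> 'm \<Rightarrow> 'e \<Rightarrow> 'e \<Rightarrow> 'm" where
  "smash_tensor A x a = (\<lambda>b. if b = a then x else \<zero>\<^bsub>A\<^esub>)"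


section \<open>The algebra S\<close>

text \<open>
  \<open>Beta\<close>, \<open>Mu k\<close>, \<open>Nu k\<close> stand for the Laurent variables \<open>L(\<lambda>\<^sub>\<beta>)\<close>, \<open>L(\<lambda>\<^sub>\<mu>\<^sub>k)\<close>, \<open>L(\<lambda>\<^sub>\<nu>\<^sub>k)\<close>.
  A Laurent monomial is represented by its exponent vector \<open>a :: lvar \<Rightarrow>\<^sub>0 int\<close>; the Laurent
  polynomial ring is the group algebra of the group of exponent vectors.
\<close>

datatype lvar = Beta | Mu nat | Nu nat

definition lvars :: "nat \<Rightarrow> lvar set" where
  "lvars n = {Beta} \<union> Mu ` {1..n - 1} \<union> Nu ` {1..n - 1}"

definition laurent_exps :: "nat \<Rightarrow> (lvar \<Rightarrow>\<^sub>0 int) set" where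
  "laurent_exps n = {a. Poly_Mapping.keys a \<subseteq> lvars n}"

text \<open>\<open>L(v) Z\<^sub>i\<^sub>j = q ^ var_wt v (i, j) Z\<^sub>i\<^sub>j L(v)\<close>\<close>

fun var_wt :: "lvar \<Rightarrow> nat \<times> nat \<Rightarrow> int" where
  "var_wt Beta (i, j) = 1"
| "var_wt (Mu k) (i, j) = (if k < i then 1 else 0)"
| "var_wt (Nu k) (i, j) = (if k < j then 1 else 0)"

definition exp_wt :: "(lvar \<Rightarrow>\<^sub>0 int) \<Rightarrow> nat \<times> nat \<Rightarrow> int" where
  "exp_wt a x = (\<Sum>v \<in> Poly_Mapping.keys a. Poly_Mapping.lookup a v * var_wt v x)"

text \<open>
  The automorphism \<open>f \<mapsto> L\<^sup>a f L\<^sup>-\<^sup>a\<close>, first on the free algebra, where it multiplies each word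
  \<open>Z\<^sub>x\<^sub>1 \<dots> Z\<^sub>x\<^sub>r\<close> by \<open>q\<close> to the power \<open>exp_wt a x\<^sub>1 + \<dots> + exp_wt a x\<^sub>r\<close>. It preserves the ideal of
  relations of \<open>M\<^sub>q(n)\<close>, so the image of a coset is a coset, and taking images is the induced
  automorphism of the quotient.
\<close>

definition free_act ::
    "complex \<Rightarrow> (lvar \<Rightarrow>\<^sub>0 int) \<Rightarrow> (nat \<times> nat) ncpoly \<Rightarrow> (nat \<times> nat) ncpoly" where
  "free_act q a f = Poly_Mapping.mapp (\<lambda>w c. q powi (\<Sum>x\<leftarrow>w. exp_wt a x) * c) f"

definition Mq_act ::
    "complex \<Rightarrow> (lvar \<Rightarrow>\<^sub>0 int) \<Rightarrow> (nat \<times> nat) ncpoly set \<Rightarrow> (nat \<times> nat) ncpoly set" where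
  "Mq_act q a C = free_act q a ` C"

type_synonym S_elt = "(lvar \<Rightarrow>\<^sub>0 int) \<Rightarrow> (nat \<times> nat) ncpoly set"

definition S_alg :: "complex \<Rightarrow> nat \<Rightarrow> (complex, S_elt) module" where
  "S_alg q n = smash (Mq q n) (laurent_exps n) (Mq_act q)"

definition Z_elt :: "complex \<Rightarrow> nat \<Rightarrow> nat \<Rightarrow> nat \<Rightarrow> S_elt" where
  "Z_elt q n i j = smash_tensor (Mq q n) (presented_gen (idx n) (Mq_rels q n) (i, j)) 0"

definition L_elt :: "complex \<Rightarrow> nat \<Rightarrow> lvar \<Rightarrow> S_elt" where
  "L_elt q n v = smash_tensor (Mq q n) \<one>\<^bsub>Mq q n\<^esub> (Poly_Mapping.single v 1)"

text \<open>\<open>L(\<lambda>\<^sub>\<mu>\<^sub>n) = L(\<lambda>\<^sub>\<nu>\<^sub>n) = 1\<close> by convention.\<close>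

definition L_beta :: "complex \<Rightarrow> nat \<Rightarrow> S_elt" where
  "L_beta q n = L_elt q n Beta"

definition L_mu :: "complex \<Rightarrow> nat \<Rightarrow> nat \<Rightarrow> S_elt" where
  "L_mu q n k = (if k = n then \<one>\<^bsub>S_alg q n\<^esub> else L_elt q n (Mu k))"

definition L_nu :: "complex \<Rightarrow> nat \<Rightarrow> nat \<Rightarrow> S_elt" where
  "L_nu q n k = (if k = n then \<one>\<^bsub>S_alg q n\<^esub> else L_elt q n (Nu k))"

definition J_elt :: "complex \<Rightarrow> nat \<Rightarrow> nat \<times> nat \<Rightarrow> S_elt" where
  "J_elt q n = (\<lambda>(i, j).
     Z_elt q n i j \<otimes>\<^bsub>S_alg q n\<^esub> L_beta q n [^]\<^bsub>S_alg q n\<^esub> (- (int i + int j))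
       \<otimes>\<^bsub>S_alg q n\<^esub> inv\<^bsub>S_alg q n\<^esub> (L_mu q n i) \<otimes>\<^bsub>S_alg q n\<^esub> inv\<^bsub>S_alg q n\<^esub> (L_nu q n j))"

definition M_elt :: "complex \<Rightarrow> nat \<Rightarrow> nat \<times> nat \<Rightarrow> S_elt" where
  "M_elt q n = (\<lambda>(i, j).
     Z_elt q n i j \<otimes>\<^bsub>S_alg q n\<^esub> inv\<^bsub>S_alg q n\<^esub> (L_mu q n i) \<otimes>\<^bsub>S_alg q n\<^esub> inv\<^bsub>S_alg q n\<^esub> (L_nu q n j))"

definition N_elt :: "complex \<Rightarrow> nat \<Rightarrow> nat \<times> nat \<Rightarrow> S_elt" where
  "N_elt q n = (\<lambda>(i, j).
     Z_elt q n i j \<otimes>\<^bsub>S_alg q n\<^esub> L_beta q n [^]\<^bsub>S_alg q n\<^esub> (- int i + int j)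
       \<otimes>\<^bsub>S_alg q n\<^esub> inv\<^bsub>S_alg q n\<^esub> (L_mu q n i) \<otimes>\<^bsub>S_alg q n\<^esub> L_nu q n j)"

end

theory Submission
  imports Defs
begin

text \<open>
  Each of the three families has the form \<open>E\<^sub>x = Z\<^sub>x L\<^sup>a\<^sup>(\<^sup>x\<^sup>)\<close>, where the exponent vector \<open>a(i, j)\<close> is a
  function of the row \<open>i\<close> plus a function of the column \<open>j\<close>. Moving the Laurent monomials to the
  right, a word \<open>w = x\<^sub>1 \<dots> x\<^sub>r\<close> in the generators is sent to
  \<open>q\<^sup>\<sigma>\<^sup>(\<^sup>w\<^sup>) Z\<^sub>x\<^sub>1 \<dots> Z\<^sub>x\<^sub>r L\<^sup>d\<close> with \<open>d = a(x\<^sub>1) + \<dots> + a(x\<^sub>r)\<close> and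
  \<open>\<sigma>(w) = \<Sum> b(x\<^sub>k, x\<^sub>l)\<close> over \<open>k < l\<close>, where \<open>b(x, y)\<close> is the weight of \<open>Z\<^sub>y\<close> under
  conjugation by \<open>L\<^sup>a\<^sup>(\<^sup>x\<^sup>)\<close>. So the homomorphism from the free algebra to the smash product is the
  rescaling of every word \<open>w\<close> by \<open>q\<^sup>\<sigma>\<^sup>(\<^sup>w\<^sup>)\<close>, followed by sorting by \<open>d\<close> and
  reduction modulo the quantum matrix relations.

  What makes this work is that the quantum matrix relations only compare words with the same rows
  and the same columns, counted with multiplicity: the words \<open>(i,j)(s,t)\<close>, \<open>(s,t)(i,j)\<close> and
  \<open>(i,t)(s,j)\<close>. As \<open>a\<close> and \<open>b\<close> split into row and column parts, \<open>d\<close> and all the factors of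
  \<open>q\<^sup>\<sigma>\<close> that come from a surrounding context agree on these words. Hence rescaling by \<open>q\<^sup>\<sigma>\<close>
  maps the ideal of the relations twisted by \<open>b\<close> onto the ideal of the quantum matrix relations,
  its inverse maps back, and both ideals are graded by \<open>d\<close>; all three facts are instances of
  \<open>reweight_twisted\<close>, which rests on the general criterion \<open>reweight_rel_ideal\<close>. Consequently the
  kernel of the homomorphism is exactly the twisted ideal (\<open>\<Phi>_kernel\<close>), and the first isomorphism
  theorem (\<open>presented_alg_iso_subalg\<close>) gives the isomorphism \<open>twisted_iso\<close> for every such \<open>a\<close>.

  It remains to compute \<open>b\<close> in the three cases and to see that the defining relations are, up to
  nonzero scalars, the twisted relations (\<open>J0_ideal_eq\<close>, \<open>Jz_ideal_eq\<close>, \<open>Jn_ideal_eq\<close>, and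
  \<open>Mq_ideal_eq\<close> for the trivial twist). Since the convention \<open>L(\<lambda>\<^sub>\<mu>\<^sub>n) = L(\<lambda>\<^sub>\<nu>\<^sub>n) = 1\<close> agrees with
  \<open>[n < i] = 0\<close> for \<open>i \<le> n\<close>, the last row and the last column need no separate treatment.
\<close>

section \<open>Free algebras\<close>

lemma in_free_alg: "f \<in> carrier (free_alg X) \<longleftrightarrow> (\<forall>w \<in> Poly_Mapping.keys f. set w \<subseteq> X)"
  by (simp add: free_alg_def)

lemma free_alg_simps [simp]:
  "mult (free_alg X) = (*)" "one (free_alg X) = 1" "zero (free_alg X) = 0"
  "add (free_alg X) = (+)" "smult (free_alg X) = nc_scale"
  by (simp_all add: free_alg_def)

lemma single_in_free_alg: "set w \<subseteq> X \<Longrightarrow> Poly_Mapping.single w c \<in> carrier (free_alg X)"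
  by (simp add: in_free_alg)

lemma gen_closed: "x \<in> X \<Longrightarrow> gen x \<in> carrier (free_alg X)"
  by (simp add: gen_def single_in_free_alg)

lemma free_alg_add_closed:
  "f \<in> carrier (free_alg X) \<Longrightarrow> g \<in> carrier (free_alg X) \<Longrightarrow> f + g \<in> carrier (free_alg X)"
  using keys_add[of f g] unfolding in_free_alg by blast

lemma free_alg_mult_closed:
  assumes "f \<in> carrier (free_alg X)" "g \<in> carrier (free_alg X)"
  shows "f * g \<in> carrier (free_alg X)"
  unfolding in_free_alg
proof
  fix w assume "w \<in> Poly_Mapping.keys (f * g)"
  then obtain u v where "w = u @ v" "u \<in> Poly_Mapping.keys f" "v \<in> Poly_Mapping.keys g"
    using keys_mult[of f g] by (auto simp: plus_list_def)
  then show "set w \<subseteq> X" using assms by (auto simp: in_free_alg)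
qed

lemma free_alg_uminus_closed: "f \<in> carrier (free_alg X) \<Longrightarrow> - f \<in> carrier (free_alg X)"
  by (simp add: in_free_alg in_keys_iff)

lemma free_alg_diff_closed:
  "f \<in> carrier (free_alg X) \<Longrightarrow> g \<in> carrier (free_alg X) \<Longrightarrow> f - g \<in> carrier (free_alg X)"
  using free_alg_add_closed[OF _ free_alg_uminus_closed, of f X g] by simp

lemma free_alg_zero_closed: "0 \<in> carrier (free_alg X)"
  by (simp add: in_free_alg)

lemma free_alg_one_closed: "1 \<in> carrier (free_alg X)"
  by (simp add: in_free_alg zero_list_def)

lemmas free_alg_closed = free_alg_add_closed free_alg_mult_closed free_alg_uminus_closed
  free_alg_diff_closed free_alg_zero_closed free_alg_one_closed

lemma ring_free_alg: "ring (free_alg X)"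
proof (rule ringI)
  show "abelian_group (free_alg X)"
  proof (rule abelian_groupI)
    show "\<exists>g\<in>carrier (free_alg X). g \<oplus>\<^bsub>free_alg X\<^esub> f = \<zero>\<^bsub>free_alg X\<^esub>"
      if "f \<in> carrier (free_alg X)" for f
      using free_alg_uminus_closed[OF that] by (intro bexI[of _ "- f"]) simp_all
  qed (simp_all add: free_alg_closed ac_simps)
  show "Group.monoid (free_alg X)"
    by (rule monoidI) (simp_all add: free_alg_closed mult.assoc)
qed (simp_all add: distrib_left distrib_right)

lemma a_minus_free_alg:
  assumes "f \<in> carrier (free_alg X)" shows "\<ominus>\<^bsub>free_alg X\<^esub> f = - f"
proof -
  interpret ring "free_alg X" by (rule ring_free_alg)
  show ?thesis using assms free_alg_uminus_closed[OF assms] minus_equality[of "- f" f] by simp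
qed

lemma lookup_nc_scale [simp]:
  "Poly_Mapping.lookup (c *\<^sub>C f) w = c * Poly_Mapping.lookup f w"
  by (simp add: nc_scale_def Poly_Mapping.map.rep_eq when_def)

lemma nc_scale_closed: "f \<in> carrier (free_alg X) \<Longrightarrow> c *\<^sub>C f \<in> carrier (free_alg X)"
  by (simp add: in_free_alg in_keys_iff)

lemma nc_scale_eq_mult: "c *\<^sub>C f = Poly_Mapping.single [] c * f"
  using mult_map_scale_conv_mult[of c f] by (simp add: nc_scale_def zero_list_def)

lemma sum_singles: "f = (\<Sum>w\<in>Poly_Mapping.keys f. Poly_Mapping.single w (Poly_Mapping.lookup f w))"
  by (rule poly_mapping_eqI)
     (auto simp: lookup_sum lookup_single when_def sum.If_cases in_keys_iff sum.delta')

lemma mult_single_scalar: "f * Poly_Mapping.single [] c = c *\<^sub>C f"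
proof -
  have "f * Poly_Mapping.single [] c =
      (\<Sum>w\<in>Poly_Mapping.keys f. Poly_Mapping.single w (Poly_Mapping.lookup f w)) * Poly_Mapping.single [] c"
    using sum_singles[of f] by simp
  also have "\<dots> = Poly_Mapping.single [] c *
      (\<Sum>w\<in>Poly_Mapping.keys f. Poly_Mapping.single w (Poly_Mapping.lookup f w))"
    by (simp add: sum_distrib_left sum_distrib_right mult_single plus_list_def mult.commute)
  finally show ?thesis using sum_singles[of f] by (simp add: nc_scale_eq_mult)
qed

lemma nc_scale_mult [simp]:
  "(c *\<^sub>C f) * g = c *\<^sub>C (f * g)" "f * (c *\<^sub>C g) = c *\<^sub>C (f * g)"
proof -
  show "(c *\<^sub>C f) * g = c *\<^sub>C (f * g)" by (simp add: nc_scale_eq_mult mult.assoc)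
  have "f * (c *\<^sub>C g) = (f * Poly_Mapping.single [] c) * g"
    by (simp add: nc_scale_eq_mult mult.assoc)
  then show "f * (c *\<^sub>C g) = c *\<^sub>C (f * g)"
    by (simp only: mult_single_scalar) (simp add: nc_scale_eq_mult mult.assoc)
qed

lemma nc_scale_simps [simp]:
  "c *\<^sub>C (f + g) = c *\<^sub>C f + c *\<^sub>C g" "c *\<^sub>C (f - g) = c *\<^sub>C f - c *\<^sub>C g"
  "c *\<^sub>C (d *\<^sub>C f) = (c * d) *\<^sub>C f" "1 *\<^sub>C f = f" "0 *\<^sub>C f = 0"
  "c *\<^sub>C Poly_Mapping.single w d = Poly_Mapping.single w (c * d)"
  by (rule poly_mapping_eqI; simp add: lookup_add lookup_minus lookup_single algebra_simps when_def)+

lemma free_alg_induct [consumes 1, case_names zero single_add]: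
  assumes f: "f \<in> carrier (free_alg X)" and "P 0"
    and step: "\<And>w c g. set w \<subseteq> X \<Longrightarrow> g \<in> carrier (free_alg X) \<Longrightarrow> P g \<Longrightarrow> P (Poly_Mapping.single w c + g)"
  shows "P f"
proof -
  have "(\<Sum>w\<in>W. Poly_Mapping.single w (Poly_Mapping.lookup f w)) \<in> carrier (free_alg X) \<and>
        P (\<Sum>w\<in>W. Poly_Mapping.single w (Poly_Mapping.lookup f w))"
    if "finite W" "W \<subseteq> Poly_Mapping.keys f" for W
    using that
  proof (induction W)
    case empty
    then show ?case using \<open>P 0\<close> by (simp add: free_alg_zero_closed)
  next
    case (insert w W)
    then have "set w \<subseteq> X" using f by (auto simp: in_free_alg)
    then show ?case
      using insert step by (simp add: free_alg_add_closed single_in_free_alg)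
  qed
  from this[of "Poly_Mapping.keys f"] show ?thesis using sum_singles[of f] by simp
qed

lemma sandwich_eq_sum:
  fixes f :: "'x ncpoly"
  shows "Poly_Mapping.single u 1 * f * Poly_Mapping.single v 1 =
   (\<Sum>w\<in>Poly_Mapping.keys f. Poly_Mapping.single (u @ w @ v) (Poly_Mapping.lookup f w))"
proof -
  have "Poly_Mapping.single u 1 * f * Poly_Mapping.single v 1 = Poly_Mapping.single u (1::complex) *
      (\<Sum>w\<in>Poly_Mapping.keys f. Poly_Mapping.single w (Poly_Mapping.lookup f w)) * Poly_Mapping.single v 1"
    using sum_singles[of f] by simp
  then show ?thesis
    by (simp add: sum_distrib_left sum_distrib_right mult_single plus_list_def)
qed


section \<open>Rescaling words and ideals of relations\<close>

text \<open>
  Diagonal operators in the basis of words. The scalars may vanish, so that twists, the action of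
  the Laurent monomials and the projections to graded components are all covered.
\<close>

definition reweight :: "('x list \<Rightarrow> complex) \<Rightarrow> 'x ncpoly \<Rightarrow> 'x ncpoly" where
  "reweight \<chi> f = Poly_Mapping.mapp (\<lambda>w c. \<chi> w * c) f"

lemma lookup_reweight [simp]:
  "Poly_Mapping.lookup (reweight \<chi> f) w = \<chi> w * Poly_Mapping.lookup f w"
  by (simp add: reweight_def lookup_mapp when_def in_keys_iff)

lemma reweight_simps [simp]:
  "reweight \<chi> (f + g) = reweight \<chi> f + reweight \<chi> g"
  "reweight \<chi> (f - g) = reweight \<chi> f - reweight \<chi> g"
  "reweight \<chi> (c *\<^sub>C f) = c *\<^sub>C reweight \<chi> f"
  "reweight \<chi> 0 = 0"
  "reweight \<chi> (Poly_Mapping.single w c) = Poly_Mapping.single w (\<chi> w * c)"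
  "reweight \<chi> (reweight \<psi> f) = reweight (\<lambda>w. \<chi> w * \<psi> w) f"
  by (rule poly_mapping_eqI; simp add: lookup_add lookup_minus lookup_single algebra_simps when_def)+

lemma reweight_sum: "reweight \<chi> (sum f A) = (\<Sum>i\<in>A. reweight \<chi> (f i))"
  by (induction A rule: infinite_finite_induct) simp_all

lemma reweight_one: "reweight (\<lambda>_. 1) f = f"
  by (rule poly_mapping_eqI) simp

lemma reweight_closed: "f \<in> carrier (free_alg X) \<Longrightarrow> reweight \<chi> f \<in> carrier (free_alg X)"
  by (simp add: in_free_alg in_keys_iff)

lemma reweight_sandwich:
  assumes "\<And>w. w \<in> Poly_Mapping.keys f \<Longrightarrow> \<chi> (u @ w @ v) = \<kappa> * \<psi> w"
  shows "reweight \<chi> (Poly_Mapping.single u 1 * f * Poly_Mapping.single v 1)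
       = \<kappa> *\<^sub>C (Poly_Mapping.single u 1 * reweight \<psi> f * Poly_Mapping.single v 1)"
proof -
  have "reweight \<psi> f =
      (\<Sum>w\<in>Poly_Mapping.keys f. Poly_Mapping.single w (\<psi> w * Poly_Mapping.lookup f w))"
    by (subst sum_singles[of f]) (simp add: reweight_sum)
  then have "\<kappa> *\<^sub>C (Poly_Mapping.single u 1 * reweight \<psi> f * Poly_Mapping.single v 1) =
     (\<Sum>w\<in>Poly_Mapping.keys f. Poly_Mapping.single (u @ w @ v) (\<kappa> * (\<psi> w * Poly_Mapping.lookup f w)))"
    by (simp add: sum_distrib_left sum_distrib_right mult_single plus_list_def nc_scale_eq_mult)
  then show ?thesis
    unfolding sandwich_eq_sum reweight_sum using assms by (simp add: mult.assoc cong: sum.cong)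
qed

lemma reweight_mult:
  assumes "\<And>u v. \<chi> (u @ v) = \<chi> u * \<chi> v"
  shows "reweight \<chi> (f * g) = reweight \<chi> f * reweight \<chi> g"
proof -
  have *: "reweight \<chi> h = (\<Sum>w\<in>Poly_Mapping.keys h. Poly_Mapping.single w (\<chi> w * Poly_Mapping.lookup h w))" for h
    by (subst sum_singles[of h]) (simp add: reweight_sum)
  have "f * g = (\<Sum>u\<in>Poly_Mapping.keys f. \<Sum>v\<in>Poly_Mapping.keys g.
      Poly_Mapping.single (u @ v) (Poly_Mapping.lookup f u * Poly_Mapping.lookup g v))"
    by (subst sum_singles[of f], subst sum_singles[of g])
       (simp add: sum_distrib_left sum_distrib_right mult_single plus_list_def sum.swap[of _ "Poly_Mapping.keys g"])
  moreover have "reweight \<chi> f * reweight \<chi> g = (\<Sum>u\<in>Poly_Mapping.keys f. \<Sum>v\<in>Poly_Mapping.keys g.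
      Poly_Mapping.single (u @ v) (\<chi> (u @ v) * (Poly_Mapping.lookup f u * Poly_Mapping.lookup g v)))"
    unfolding * by (simp add: sum_distrib_left sum_distrib_right mult_single plus_list_def assms
        mult.assoc mult.left_commute sum.swap[of _ "Poly_Mapping.keys g"])
  ultimately show ?thesis by (simp add: reweight_sum)
qed

definition wf_rels :: "'x set \<Rightarrow> ('x ncpoly \<times> 'x ncpoly) set \<Rightarrow> bool" where
  "wf_rels X R \<longleftrightarrow> R \<subseteq> carrier (free_alg X) \<times> carrier (free_alg X)"

lemma wf_relsD: "wf_rels X R \<Longrightarrow> (l, r) \<in> R \<Longrightarrow> l - r \<in> carrier (free_alg X)"
  unfolding wf_rels_def using free_alg_diff_closed by blast

lemma ideal_rel_ideal: "wf_rels X R \<Longrightarrow> ideal (rel_ideal X R) (free_alg X)"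
  unfolding rel_ideal_def using wf_relsD
  by (intro ring.genideal_ideal[OF ring_free_alg]) force

lemma rel_idealI: "wf_rels X R \<Longrightarrow> (l, r) \<in> R \<Longrightarrow> l - r \<in> rel_ideal X R"
  unfolding rel_ideal_def using wf_relsD
  by (intro subsetD[OF ring.genideal_self[OF ring_free_alg]]) force+

lemma rel_ideal_minimal:
  "ideal W (free_alg X) \<Longrightarrow> (\<And>l r. (l, r) \<in> R \<Longrightarrow> l - r \<in> W) \<Longrightarrow> rel_ideal X R \<subseteq> W"
  unfolding rel_ideal_def by (intro ring.genideal_minimal[OF ring_free_alg]) auto

lemma rel_ideal_closed:
  assumes "wf_rels X R"
  shows "rel_ideal X R \<subseteq> carrier (free_alg X)" "0 \<in> rel_ideal X R"
    "f \<in> rel_ideal X R \<Longrightarrow> g \<in> rel_ideal X R \<Longrightarrow> f + g \<in> rel_ideal X R"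
    "f \<in> rel_ideal X R \<Longrightarrow> g \<in> carrier (free_alg X) \<Longrightarrow> f * g \<in> rel_ideal X R"
    "f \<in> rel_ideal X R \<Longrightarrow> g \<in> carrier (free_alg X) \<Longrightarrow> g * f \<in> rel_ideal X R"
    "f \<in> rel_ideal X R \<Longrightarrow> c *\<^sub>C f \<in> rel_ideal X R"
proof -
  interpret ideal "rel_ideal X R" "free_alg X" by (rule ideal_rel_ideal[OF assms])
  show sub: "rel_ideal X R \<subseteq> carrier (free_alg X)" by (rule a_subset)
  show "0 \<in> rel_ideal X R" using additive_subgroup.zero_closed[OF is_additive_subgroup] by simp
  show "f \<in> rel_ideal X R \<Longrightarrow> g \<in> rel_ideal X R \<Longrightarrow> f + g \<in> rel_ideal X R"
    using additive_subgroup.a_closed[OF is_additive_subgroup] by simp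
  show "f \<in> rel_ideal X R \<Longrightarrow> g \<in> carrier (free_alg X) \<Longrightarrow> f * g \<in> rel_ideal X R"
    using I_r_closed by simp
  show left: "f \<in> rel_ideal X R \<Longrightarrow> g \<in> carrier (free_alg X) \<Longrightarrow> g * f \<in> rel_ideal X R" for g
    using I_l_closed by simp
  show "f \<in> rel_ideal X R \<Longrightarrow> c *\<^sub>C f \<in> rel_ideal X R"
    unfolding nc_scale_eq_mult by (rule left) (simp_all add: single_in_free_alg)
qed

text \<open>
  An ideal of relations \<open>\<rho>\<close> is spanned by the sandwiches \<open>u \<rho> v\<close>. If the scalar of \<open>u w v\<close> is
  a constant, depending on the context \<open>(u, v)\<close> alone, times a scalar \<open>\<psi> w\<close> for all words \<open>w\<close>
  of \<open>\<rho>\<close>, then \<open>u \<rho> v\<close> is sent to a multiple of the sandwich of the rescaled relation. The proof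
  avoids the spanning set: the elements all of whose sandwiches are sent into the target form an
  ideal.
\<close>

lemma reweight_rel_ideal:
  assumes R: "wf_rels X R" and R': "wf_rels X R'"
    and rel: "\<And>l r. (l, r) \<in> R \<Longrightarrow> \<exists>\<psi>. reweight \<psi> (l - r) \<in> rel_ideal X R' \<and>
      (\<forall>u v. set u \<subseteq> X \<longrightarrow> set v \<subseteq> X \<longrightarrow>
        (\<exists>\<kappa>. \<forall>w\<in>Poly_Mapping.keys (l - r). \<chi> (u @ w @ v) = \<kappa> * \<psi> w))"
    and f: "f \<in> rel_ideal X R"
  shows "reweight \<chi> f \<in> rel_ideal X R'"
proof -
  note closed = rel_ideal_closed[OF R']
  \<comment> \<open>Requiring the property for all sandwiches at once is what makes \<open>W\<close> closed under multiplication.\<close>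
  define W where "W = {f \<in> carrier (free_alg X). \<forall>u v. set u \<subseteq> X \<longrightarrow> set v \<subseteq> X \<longrightarrow>
    reweight \<chi> (Poly_Mapping.single u 1 * f * Poly_Mapping.single v 1) \<in> rel_ideal X R'}"
  have W_carrier: "f \<in> carrier (free_alg X)" if "f \<in> W" for f using that unfolding W_def by blast
  have W_sandwich: "reweight \<chi> (Poly_Mapping.single u 1 * f * Poly_Mapping.single v 1) \<in> rel_ideal X R'"
    if "f \<in> W" "set u \<subseteq> X" "set v \<subseteq> X" for f u v using that unfolding W_def by blast
  have W_add: "f + g \<in> W" if "f \<in> W" "g \<in> W" for f g
    using that free_alg_add_closed[OF W_carrier W_carrier] unfolding W_def
    by (simp add: distrib_left distrib_right closed)
  have W_zero: "0 \<in> W" using closed unfolding W_def by (simp add: free_alg_zero_closed)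
  have W_left: "Poly_Mapping.single w c * f \<in> W" if "f \<in> W" "set w \<subseteq> X" for f w c
    unfolding W_def
  proof (intro CollectI conjI allI impI)
    show "Poly_Mapping.single w c * f \<in> carrier (free_alg X)"
      using that by (intro free_alg_mult_closed single_in_free_alg W_carrier)
    fix u v assume uv: "set u \<subseteq> X" "set v \<subseteq> X"
    have *: "Poly_Mapping.single u 1 * Poly_Mapping.single w c = c *\<^sub>C Poly_Mapping.single (u @ w) 1"
      by (simp add: mult_single plus_list_def)
    have "Poly_Mapping.single u 1 * (Poly_Mapping.single w c * f) * Poly_Mapping.single v 1
       = (Poly_Mapping.single u 1 * Poly_Mapping.single w c) * f * Poly_Mapping.single v 1"
      by (simp only: mult.assoc)
    also have "\<dots> = c *\<^sub>C (Poly_Mapping.single (u @ w) 1 * f * Poly_Mapping.single v 1)"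
      unfolding * by (simp only: nc_scale_mult)
    finally show "reweight \<chi> (Poly_Mapping.single u 1 * (Poly_Mapping.single w c * f) * Poly_Mapping.single v 1)
        \<in> rel_ideal X R'"
      using W_sandwich[of f "u @ w" v] closed(6) that uv by simp
  qed
  have W_right: "f * Poly_Mapping.single w c \<in> W" if "f \<in> W" "set w \<subseteq> X" for f w c
    unfolding W_def
  proof (intro CollectI conjI allI impI)
    show "f * Poly_Mapping.single w c \<in> carrier (free_alg X)"
      using that by (intro free_alg_mult_closed single_in_free_alg W_carrier)
    fix u v assume uv: "set u \<subseteq> X" "set v \<subseteq> X"
    have *: "Poly_Mapping.single w c * Poly_Mapping.single v 1 = c *\<^sub>C Poly_Mapping.single (w @ v) 1"
      by (simp add: mult_single plus_list_def)
    have "Poly_Mapping.single u 1 * (f * Poly_Mapping.single w c) * Poly_Mapping.single v 1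
       = Poly_Mapping.single u 1 * f * (Poly_Mapping.single w c * Poly_Mapping.single v 1)"
      by (simp only: mult.assoc)
    also have "\<dots> = c *\<^sub>C (Poly_Mapping.single u 1 * f * Poly_Mapping.single (w @ v) 1)"
      unfolding * by (simp only: nc_scale_mult)
    finally show "reweight \<chi> (Poly_Mapping.single u 1 * (f * Poly_Mapping.single w c) * Poly_Mapping.single v 1)
        \<in> rel_ideal X R'"
      using W_sandwich[of f u "w @ v"] closed(6) that uv by simp
  qed
  have W_mult: "g * f \<in> W" "f * g \<in> W" if "f \<in> W" "g \<in> carrier (free_alg X)" for f g
  proof -
    show "g * f \<in> W" using that(2)
      by (induction rule: free_alg_induct)
        (simp_all add: W_zero distrib_right W_add W_left that(1))
    show "f * g \<in> W" using that(2)
      by (induction rule: free_alg_induct)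
        (simp_all add: W_zero distrib_left W_add W_right that(1))
  qed
  have W_uminus: "- f \<in> W" if "f \<in> W" for f
  proof -
    have "- f = Poly_Mapping.single [] (-1) * f"
      unfolding nc_scale_eq_mult[symmetric] by (rule poly_mapping_eqI) simp
    then show ?thesis using W_left[OF that, of "[]"] by simp
  qed
  have "ideal W (free_alg X)"
  proof (rule idealI[OF ring_free_alg])
    interpret F: ring "free_alg X" by (rule ring_free_alg)
    have m: "\<ominus>\<^bsub>free_alg X\<^esub> f \<in> W" if "f \<in> W" for f
      using that W_uminus a_minus_free_alg[OF W_carrier[OF that]] by metis
    have ne: "W \<noteq> {}" using W_zero by blast
    have sub: "W \<subseteq> carrier (free_alg X)" using W_carrier by blast
    show "subgroup W (add_monoid (free_alg X))"
      by (rule F.add.subgroupI)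
         (use ne sub W_add m in \<open>auto simp: a_inv_def\<close>)
  qed (use W_mult in \<open>simp_all\<close>)
  moreover have "l - r \<in> W" if lr: "(l, r) \<in> R" for l r
    unfolding W_def
  proof (intro CollectI conjI allI impI)
    show "l - r \<in> carrier (free_alg X)" using wf_relsD[OF R lr] .
    fix u v assume uv: "set u \<subseteq> X" "set v \<subseteq> X"
    obtain \<psi> \<kappa> where \<psi>: "reweight \<psi> (l - r) \<in> rel_ideal X R'"
      and \<kappa>: "\<And>w. w\<in>Poly_Mapping.keys (l - r) \<Longrightarrow> \<chi> (u @ w @ v) = \<kappa> * \<psi> w"
      using rel[OF lr] uv by meson
    have "reweight \<chi> (Poly_Mapping.single u 1 * (l - r) * Poly_Mapping.single v 1)
        = \<kappa> *\<^sub>C (Poly_Mapping.single u 1 * reweight \<psi> (l - r) * Poly_Mapping.single v 1)"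
      by (rule reweight_sandwich) (rule \<kappa>)
    also have "\<dots> \<in> rel_ideal X R'"
      by (rule closed(6)[OF closed(4)[OF closed(5)[OF \<psi>]]]) (use uv in \<open>simp_all add: single_in_free_alg\<close>)
    finally show "reweight \<chi> (Poly_Mapping.single u 1 * (l - r) * Poly_Mapping.single v 1) \<in> rel_ideal X R'" .
  qed
  ultimately have "f \<in> W" using f rel_ideal_minimal[of W X R] by blast
  from W_sandwich[OF this, of "[]" "[]"] show ?thesis
    using mult_single_scalar[of f 1] by (simp add: nc_scale_eq_mult[symmetric])
qed

lemma rel_ideal_mono:
  assumes R: "wf_rels X R" and R': "wf_rels X R'"
    and "\<And>l r. (l, r) \<in> R \<Longrightarrow> l - r \<in> rel_ideal X R'"
  shows "rel_ideal X R \<subseteq> rel_ideal X R'"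
  using assms(3) by (intro rel_ideal_minimal ideal_rel_ideal[OF R'])

section \<open>Algebras given by generators and relations\<close>

definition coset :: "'x set \<Rightarrow> ('x ncpoly \<times> 'x ncpoly) set \<Rightarrow> 'x ncpoly \<Rightarrow> 'x ncpoly set" where
  "coset X R f = rel_ideal X R +>\<^bsub>free_alg X\<^esub> f"

lemma presented_gen_eq_coset: "presented_gen X R x = coset X R (gen x)"
  by (simp add: presented_gen_def coset_def)

lemma coset_eq_image: "coset X R f = (\<lambda>h. h + f) ` rel_ideal X R"
  by (auto simp: coset_def a_r_coset_def')

lemma presented_alg_Quot:
  "carrier (presented_alg X R) = carrier (free_alg X Quot rel_ideal X R)"
  "mult (presented_alg X R) = mult (free_alg X Quot rel_ideal X R)"
  "one (presented_alg X R) = one (free_alg X Quot rel_ideal X R)"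
  "zero (presented_alg X R) = zero (free_alg X Quot rel_ideal X R)"
  "add (presented_alg X R) = add (free_alg X Quot rel_ideal X R)"
  by (simp_all add: presented_alg_def Let_def)

lemma carrier_presented_alg: "carrier (presented_alg X R) = coset X R ` carrier (free_alg X)"
  unfolding presented_alg_Quot coset_def by (auto simp: FactRing_def A_RCOSETS_def')

lemma coset_closed: "f \<in> carrier (free_alg X) \<Longrightarrow> coset X R f \<in> carrier (presented_alg X R)"
  by (simp add: carrier_presented_alg)

context
  fixes X :: "'x set" and R
  assumes R: "wf_rels X R"
begin

interpretation ideal "rel_ideal X R" "free_alg X" by (rule ideal_rel_ideal[OF R])

lemma ring_presented_alg: "ring (presented_alg X R)"
proof -
  interpret Q: ring "free_alg X Quot rel_ideal X R" by (rule quotient_is_ring)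
  show ?thesis
  proof (rule ringI)
    show "abelian_group (presented_alg X R)"
    proof (rule abelian_groupI, unfold presented_alg_Quot)
      fix x assume "x \<in> carrier (free_alg X Quot rel_ideal X R)"
      then show "\<exists>y\<in>carrier (free_alg X Quot rel_ideal X R).
          y \<oplus>\<^bsub>free_alg X Quot rel_ideal X R\<^esub> x = \<zero>\<^bsub>free_alg X Quot rel_ideal X R\<^esub>"
        using Q.l_neg Q.a_inv_closed by blast
    qed (fact Q.ring_simprules | assumption | rule Q.ring_simprules)+
    show "Group.monoid (presented_alg X R)"
      by (rule monoidI, unfold presented_alg_Quot) (assumption | rule Q.ring_simprules Q.r_one)+
  qed (unfold presented_alg_Quot, (assumption | rule Q.l_distr Q.r_distr)+)
qed

lemma coset_eq_iff:
  assumes f: "f \<in> carrier (free_alg X)" and g: "g \<in> carrier (free_alg X)"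
  shows "coset X R f = coset X R g \<longleftrightarrow> f - g \<in> rel_ideal X R"
proof
  assume "coset X R f = coset X R g"
  moreover have "f \<in> coset X R f"
    unfolding coset_eq_image using rel_ideal_closed(2)[OF R] by (auto intro: image_eqI[of _ _ 0])
  ultimately obtain h where "h \<in> rel_ideal X R" "f = h + g" unfolding coset_eq_image by auto
  then show "f - g \<in> rel_ideal X R" by simp
next
  assume "f - g \<in> rel_ideal X R"
  then have "f \<in> coset X R g" unfolding coset_eq_image by (auto intro!: image_eqI[of _ _ "f - g"])
  then show "coset X R f = coset X R g"
    unfolding coset_def using a_repr_independence[OF _ g a_subgroup] by metis
qed

lemma coset_hom:
  assumes f: "f \<in> carrier (free_alg X)" and g: "g \<in> carrier (free_alg X)"
  shows "coset X R f \<oplus>\<^bsub>presented_alg X R\<^esub> coset X R g = coset X R (f + g)"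
    and "coset X R f \<otimes>\<^bsub>presented_alg X R\<^esub> coset X R g = coset X R (f * g)"
  using ring_hom_add[OF rcos_ring_hom f g] ring_hom_mult[OF rcos_ring_hom f g]
  unfolding presented_alg_Quot coset_def by simp_all

lemma coset_one: "\<one>\<^bsub>presented_alg X R\<^esub> = coset X R 1"
  using ring_hom_one[OF rcos_ring_hom] unfolding presented_alg_Quot coset_def by simp

lemma coset_zero: "\<zero>\<^bsub>presented_alg X R\<^esub> = coset X R 0"
  by (simp add: presented_alg_Quot coset_eq_image FactRing_def)

lemma coset_eq_zero_iff:
  "f \<in> carrier (free_alg X) \<Longrightarrow> coset X R f = \<zero>\<^bsub>presented_alg X R\<^esub> \<longleftrightarrow> f \<in> rel_ideal X R"
  using coset_eq_iff[of f 0] by (simp add: coset_zero free_alg_closed)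

lemma coset_smult:
  assumes f: "f \<in> carrier (free_alg X)"
  shows "c \<odot>\<^bsub>presented_alg X R\<^esub> coset X R f = coset X R (c *\<^sub>C f)"
proof -
  note closed = rel_ideal_closed[OF R]
  have "c \<odot>\<^bsub>presented_alg X R\<^esub> coset X R f
      = rel_ideal X R <+>\<^bsub>free_alg X\<^esub> (\<lambda>f. c *\<^sub>C f) ` (\<lambda>h. h + f) ` rel_ideal X R"
    unfolding coset_eq_image by (simp add: presented_alg_def Let_def)
  also have "\<dots> = {h + c *\<^sub>C (h' + f) | h h'. h \<in> rel_ideal X R \<and> h' \<in> rel_ideal X R}"
    unfolding set_add_def' free_alg_simps by blast
  also have "\<dots> = coset X R (c *\<^sub>C f)"
    unfolding coset_eq_image
  proof safe
    fix h h' assume "h \<in> rel_ideal X R" "h' \<in> rel_ideal X R"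
    then show "h + c *\<^sub>C (h' + f) \<in> (\<lambda>h. h + c *\<^sub>C f) ` rel_ideal X R"
      by (intro image_eqI[of _ _ "h + c *\<^sub>C h'"]) (simp_all add: closed add.assoc)
  next
    fix h assume "h \<in> rel_ideal X R"
    then show "\<exists>h'' h'. h + c *\<^sub>C f = h'' + c *\<^sub>C (h' + f) \<and> h'' \<in> rel_ideal X R \<and> h' \<in> rel_ideal X R"
      by (intro exI[of _ h] exI[of _ 0]) (simp add: closed)
  qed
  finally show ?thesis .
qed

end

lemma hom_free_alg_monom_in_subalg:
  assumes hom: "\<Phi> \<in> ring_hom (free_alg X) S"
    and V: "is_subalg V S" and gens: "\<Phi> ` gen ` X \<subseteq> V" and w: "set w \<subseteq> X"
  shows "\<Phi> (Poly_Mapping.single w 1) \<in> V"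
  using w
proof (induction w)
  case Nil
  have one: "Poly_Mapping.single [] 1 = (1 :: 'a ncpoly)"
    unfolding zero_list_def[symmetric] by (rule single_one)
  then show ?case
    unfolding one using ring_hom_one[OF hom] V subringE(3)[of V S] by (simp add: is_subalg_def)
next
  case (Cons x w)
  have "Poly_Mapping.single (x # w) 1 = gen x * Poly_Mapping.single w (1::complex)"
    by (simp add: gen_def mult_single plus_list_def)
  moreover have "gen x \<in> carrier (free_alg X)" "Poly_Mapping.single w 1 \<in> carrier (free_alg X)"
    using Cons by (simp_all add: gen_def single_in_free_alg)
  ultimately have "\<Phi> (Poly_Mapping.single (x # w) 1) = \<Phi> (gen x) \<otimes>\<^bsub>S\<^esub> \<Phi> (Poly_Mapping.single w 1)"
    using ring_hom_mult[OF hom, of "gen x" "Poly_Mapping.single w 1"] by simp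
  moreover have "\<Phi> (Poly_Mapping.single w 1) \<in> V" "\<Phi> (gen x) \<in> V"
    using Cons gens by auto
  ultimately show ?case
    using V subringE(6)[of V S] unfolding is_subalg_def by metis
qed

text \<open>
  A subalgebra that contains the images of the generators contains the images of all words, and
  every element is a linear combination of words; conversely, the image is a subalgebra.
\<close>

lemma subalg_gen_hom_image:
  fixes S :: "(complex, 's) module"
  assumes S: "ring S" and hom: "\<Phi> \<in> ring_hom (free_alg X) S"
    and scale: "\<And>c f. f \<in> carrier (free_alg X) \<Longrightarrow> \<Phi> (c *\<^sub>C f) = c \<odot>\<^bsub>S\<^esub> \<Phi> f"
  shows "subalg_gen S (\<Phi> ` gen ` X) = S\<lparr>carrier := \<Phi> ` carrier (free_alg X)\<rparr>"
proof -
  let ?F = "carrier (free_alg X)"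
  have "is_subalg (\<Phi> ` ?F) S"
    unfolding is_subalg_def
  proof
    interpret ring_hom_ring "free_alg X" S \<Phi> by (rule ring_hom_ringI2[OF ring_free_alg S hom])
    show "subring (\<Phi> ` ?F) S"
      using img_is_subring[OF R.carrier_is_subring] .
    show "\<forall>c. \<forall>v\<in>\<Phi> ` ?F. c \<odot>\<^bsub>S\<^esub> v \<in> \<Phi> ` ?F"
    proof safe
      fix c f assume "f \<in> ?F"
      then show "c \<odot>\<^bsub>S\<^esub> \<Phi> f \<in> \<Phi> ` ?F"
        by (intro image_eqI[of _ _ "c *\<^sub>C f"]) (simp_all add: scale nc_scale_closed)
    qed
  qed
  moreover have "\<Phi> ` gen ` X \<subseteq> \<Phi> ` ?F" by (auto simp: gen_def single_in_free_alg)
  moreover have "\<Phi> ` ?F \<subseteq> V" if V: "is_subalg V S" "\<Phi> ` gen ` X \<subseteq> V" for V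
  proof safe
    have sub: "subring V S" and sc: "\<And>c v. v \<in> V \<Longrightarrow> c \<odot>\<^bsub>S\<^esub> v \<in> V"
      using V(1) by (auto simp: is_subalg_def)
    fix f assume "f \<in> ?F"
    then show "\<Phi> f \<in> V"
    proof (induction rule: free_alg_induct)
      case zero
      then show ?case
        using ring_hom_zero[OF hom ring_free_alg S] subringE(2)[OF sub] by simp
    next
      case (single_add w c g)
      have "\<Phi> (Poly_Mapping.single w c) = c \<odot>\<^bsub>S\<^esub> \<Phi> (Poly_Mapping.single w 1)"
        using scale[of "Poly_Mapping.single w 1" c] single_add by (simp add: single_in_free_alg)
      then have "\<Phi> (Poly_Mapping.single w c) \<in> V"
        using sc hom_free_alg_monom_in_subalg[OF hom V] single_add by simp
      then show ?case
        using ring_hom_add[OF hom, of "Poly_Mapping.single w c" g] single_add subringE(7)[OF sub]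
        by (simp add: single_in_free_alg)
    qed
  qed
  ultimately have "\<Inter>{V. is_subalg V S \<and> \<Phi> ` gen ` X \<subseteq> V} = \<Phi> ` ?F"
    by (intro equalityI Inter_lower Inter_greatest) simp_all
  then show ?thesis by (simp add: subalg_gen_def)
qed

text \<open>
  The first isomorphism theorem for rings, upgraded to algebras: the induced map on cosets
  respects scalars because the homomorphism does.
\<close>

theorem presented_alg_iso_subalg:
  fixes S :: "(complex, 's) module"
  assumes R: "wf_rels X R" and S: "ring S" and hom: "\<Phi> \<in> ring_hom (free_alg X) S"
    and scale: "\<And>c f. f \<in> carrier (free_alg X) \<Longrightarrow> \<Phi> (c *\<^sub>C f) = c \<odot>\<^bsub>S\<^esub> \<Phi> f"
    and ker: "\<And>f. f \<in> carrier (free_alg X) \<Longrightarrow> \<Phi> f = \<zero>\<^bsub>S\<^esub> \<longleftrightarrow> f \<in> rel_ideal X R"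
  shows "\<exists>\<phi> \<in> alg_iso (presented_alg X R) (subalg_gen S (\<Phi> ` gen ` X)).
    \<forall>x\<in>X. \<phi> (presented_gen X R x) = \<Phi> (gen x)"
proof -
  interpret ring_hom_ring "free_alg X" S \<Phi> by (rule ring_hom_ringI2[OF ring_free_alg S hom])
  have kernel: "a_kernel (free_alg X) S \<Phi> = rel_ideal X R"
    unfolding a_kernel_def' using ker rel_ideal_closed(1)[OF R] by blast
  define \<phi> where "\<phi> = (\<lambda>C. the_elem (\<Phi> ` C))"
  have \<phi>_coset: "\<phi> (coset X R f) = \<Phi> f" if "f \<in> carrier (free_alg X)" for f
    using the_elem_simp[OF that] by (simp add: \<phi>_def coset_def kernel)
  have "\<phi> \<in> ring_iso (presented_alg X R) (S\<lparr>carrier := \<Phi> ` carrier (free_alg X)\<rparr>)"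
    using FactRing_iso_set_aux
    unfolding ring_iso_def ring_hom_def presented_alg_Quot kernel \<phi>_def .
  moreover have "\<phi> (c \<odot>\<^bsub>presented_alg X R\<^esub> C) = c \<odot>\<^bsub>S\<^esub> \<phi> C"
    if carr: "C \<in> carrier (presented_alg X R)" for c C
  proof -
    obtain f where f: "f \<in> carrier (free_alg X)" and C: "C = coset X R f"
      using carr unfolding carrier_presented_alg by blast
    show ?thesis
      unfolding C using f by (simp add: coset_smult[OF R] \<phi>_coset nc_scale_closed scale)
  qed
  ultimately have "\<phi> \<in> alg_iso (presented_alg X R) (subalg_gen S (\<Phi> ` gen ` X))"
    by (simp add: subalg_gen_hom_image[OF S hom] scale alg_iso_def)
  moreover have "\<forall>x\<in>X. \<phi> (presented_gen X R x) = \<Phi> (gen x)"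
    by (simp add: presented_gen_eq_coset \<phi>_coset gen_def single_in_free_alg)
  ultimately show ?thesis by blast
qed

lemma presented_alg_cong:
  "rel_ideal X R = rel_ideal X R' \<Longrightarrow> presented_alg X R = presented_alg X R'"
  "rel_ideal X R = rel_ideal X R' \<Longrightarrow> presented_gen X R = presented_gen X R'"
  unfolding presented_alg_def presented_gen_def by (simp_all only:)

section \<open>Smash products\<close>

text \<open>
  The conditions under which the smash product is an associative ring. They control \<open>act a\<close> only
  for \<open>a \<in> G\<close>, and sums are therefore always taken over subsets of \<open>G\<close>.
\<close>

locale smash_data = A: ring A for A :: "(complex, 'm) module" (structure) +
  fixes G :: "'e::ab_group_add set" and act :: "'e \<Rightarrow> 'm \<Rightarrow> 'm"
  assumes G_zero: "0 \<in> G" and G_diff: "a \<in> G \<Longrightarrow> b \<in> G \<Longrightarrow> a - b \<in> G"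
    and act_hom: "a \<in> G \<Longrightarrow> act a \<in> ring_hom A A"
    and act_0: "x \<in> carrier A \<Longrightarrow> act 0 x = x"
    and act_add: "a \<in> G \<Longrightarrow> b \<in> G \<Longrightarrow> x \<in> carrier A \<Longrightarrow> act (a + b) x = act a (act b x)"
begin

abbreviation S where "S \<equiv> smash A G act"

lemma G_uminus: "a \<in> G \<Longrightarrow> - a \<in> G"
  using G_diff[OF G_zero, of a] by simp

lemma G_add: "a \<in> G \<Longrightarrow> b \<in> G \<Longrightarrow> a + b \<in> G"
  using G_diff[OF _ G_uminus, of a b] by simp

lemma act_closed [simp]: "a \<in> G \<Longrightarrow> x \<in> carrier A \<Longrightarrow> act a x \<in> carrier A"
  using ring_hom_closed[OF act_hom] .

lemma act_mult: "a \<in> G \<Longrightarrow> x \<in> carrier A \<Longrightarrow> y \<in> carrier A \<Longrightarrow> act a (x \<otimes> y) = act a x \<otimes> act a y"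
  using ring_hom_mult[OF act_hom] .

lemma act_plus: "a \<in> G \<Longrightarrow> x \<in> carrier A \<Longrightarrow> y \<in> carrier A \<Longrightarrow> act a (x \<oplus> y) = act a x \<oplus> act a y"
  using ring_hom_add[OF act_hom] .

lemma act_one [simp]: "a \<in> G \<Longrightarrow> act a \<one> = \<one>"
  using ring_hom_one[OF act_hom] .

lemma act_zero [simp]: "a \<in> G \<Longrightarrow> act a \<zero> = \<zero>"
  using ring_hom_zero[OF act_hom A.ring_axioms A.ring_axioms] .

lemma act_finsum:
  assumes "a \<in> G" "finite T" "\<And>t. t \<in> T \<Longrightarrow> f t \<in> carrier A"
  shows "act a (\<Oplus>t\<in>T. f t) = (\<Oplus>t\<in>T. act a (f t))"
  using assms(2,3)
  by (induction T) (simp_all add: \<open>a \<in> G\<close> act_plus Pi_def)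

lemma finsum_swap:
  assumes "finite T" "finite U" "\<And>t u. t \<in> T \<Longrightarrow> u \<in> U \<Longrightarrow> f t u \<in> carrier A"
  shows "(\<Oplus>t\<in>T. \<Oplus>u\<in>U. f t u) = (\<Oplus>u\<in>U. \<Oplus>t\<in>T. f t u)"
  using assms(1,3)
proof (induction T)
  case (insert t T)
  have "(\<Oplus>u\<in>U. \<Oplus>t\<in>insert t T. f t u) = (\<Oplus>u\<in>U. f t u \<oplus> (\<Oplus>t\<in>T. f t u))"
    by (rule A.finsum_cong') (use insert in \<open>auto intro!: A.finsum_closed\<close>)
  also have "\<dots> = (\<Oplus>u\<in>U. f t u) \<oplus> (\<Oplus>u\<in>U. \<Oplus>t\<in>T. f t u)"
    by (rule A.finsum_addf) (use insert in \<open>auto intro!: A.finsum_closed\<close>)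
  finally show ?case
    using insert by (simp add: Pi_def A.finsum_closed)
qed simp

lemma in_S: "f \<in> carrier S \<longleftrightarrow>
  (\<forall>a. f a \<in> carrier A) \<and> (\<forall>a. a \<notin> G \<longrightarrow> f a = \<zero>) \<and> finite {a. f a \<noteq> \<zero>}"
  by (simp add: smash_def)

lemma S_apply_closed: "f \<in> carrier S \<Longrightarrow> f a \<in> carrier A"
  by (simp add: in_S)

lemma S_simps [simp]:
  "(f \<oplus>\<^bsub>S\<^esub> h) a = f a \<oplus> h a" "\<zero>\<^bsub>S\<^esub> a = \<zero>" "(c \<odot>\<^bsub>S\<^esub> f) a = c \<odot> f a"
  "\<one>\<^bsub>S\<^esub> a = (if a = 0 then \<one> else \<zero>)"
  by (simp_all add: smash_def)


definition supp where "supp f = {a. f a \<noteq> \<zero>}"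

lemma supp_in_S: "f \<in> carrier S \<Longrightarrow> finite (supp f) \<and> supp f \<subseteq> G"
  unfolding supp_def in_S by auto

text \<open>
  The sum in the product may be extended to any finite subset of \<open>G\<close> that contains the support,
  which lets sums for different factors be compared term by term.
\<close>

lemma S_mult:
  assumes "f \<in> carrier S" "h \<in> carrier S" "finite T" "supp f \<subseteq> T" "T \<subseteq> G"
  shows "(f \<otimes>\<^bsub>S\<^esub> h) c = (\<Oplus>a\<in>T. f a \<otimes> act a (h (c - a)))"
proof -
  have "(f \<otimes>\<^bsub>S\<^esub> h) c = (\<Oplus>a\<in>supp f. f a \<otimes> act a (h (c - a)))"
    by (simp add: smash_def supp_def)
  also have "\<dots> = (\<Oplus>a\<in>T. f a \<otimes> act a (h (c - a)))"
  proof (rule A.add.finprod_mono_neutral_cong_left)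
    fix a assume "a \<in> T - supp f"
    then show "f a \<otimes> act a (h (c - a)) = \<zero>"
      using assms S_apply_closed[OF assms(2)] by (auto simp: supp_def)
  qed (use assms S_apply_closed in auto)
  finally show ?thesis .
qed

lemma S_mult_closed:
  assumes f: "f \<in> carrier S" and h: "h \<in> carrier S"
  shows "f \<otimes>\<^bsub>S\<^esub> h \<in> carrier S"
proof -
  note sf = supp_in_S[OF f] and sh = supp_in_S[OF h]
  have zero: "(f \<otimes>\<^bsub>S\<^esub> h) c = \<zero>" if "\<And>a. a \<in> supp f \<Longrightarrow> h (c - a) = \<zero>" for c
  proof -
    have "(f \<otimes>\<^bsub>S\<^esub> h) c = (\<Oplus>a\<in>supp f. f a \<otimes> act a (h (c - a)))"
      using sf by (intro S_mult f h) auto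
    also have "\<dots> = \<zero>"
      by (rule A.add.finprod_one_eqI) (use sf that S_apply_closed[OF f] in auto)
    finally show ?thesis .
  qed
  have "{c. (f \<otimes>\<^bsub>S\<^esub> h) c \<noteq> \<zero>} \<subseteq> (\<lambda>(a, b). a + b) ` (supp f \<times> supp h)"
  proof
    fix c assume "c \<in> {c. (f \<otimes>\<^bsub>S\<^esub> h) c \<noteq> \<zero>}"
    then obtain a where "a \<in> supp f" "h (c - a) \<noteq> \<zero>" using zero by blast
    then show "c \<in> (\<lambda>(a, b). a + b) ` (supp f \<times> supp h)"
      by (intro image_eqI[of _ _ "(a, c - a)"]) (auto simp: supp_def)
  qed
  then have "finite {c. (f \<otimes>\<^bsub>S\<^esub> h) c \<noteq> \<zero>}" using sf sh finite_subset by blast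
  moreover have "(f \<otimes>\<^bsub>S\<^esub> h) c = \<zero>" if "c \<notin> G" for c
  proof (rule zero)
    fix a assume "a \<in> supp f"
    then have "c - a \<notin> G" using G_add[of "c - a" a] sf that by auto
    then show "h (c - a) = \<zero>" using h by (simp add: in_S)
  qed
  moreover have "(f \<otimes>\<^bsub>S\<^esub> h) c \<in> carrier A" for c
    using S_mult[OF f h _ order_refl] sf S_apply_closed[OF f] S_apply_closed[OF h]
    by (auto intro!: A.finsum_closed)
  ultimately show ?thesis by (simp add: in_S)
qed

lemma S_add_closed:
  assumes f: "f \<in> carrier S" and h: "h \<in> carrier S"
  shows "f \<oplus>\<^bsub>S\<^esub> h \<in> carrier S"
proof -
  have "{a. (f \<oplus>\<^bsub>S\<^esub> h) a \<noteq> \<zero>} \<subseteq> supp f \<union> supp h" by (auto simp: supp_def)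
  then show ?thesis
    using f h supp_in_S[OF f] supp_in_S[OF h] unfolding in_S
    by (auto intro: finite_subset)
qed

lemma S_uminus_closed: "f \<in> carrier S \<Longrightarrow> (\<lambda>a. \<ominus> f a) \<in> carrier S"
  by (auto simp: in_S elim!: rev_finite_subset)

lemma S_zero_closed: "\<zero>\<^bsub>S\<^esub> \<in> carrier S" by (simp add: in_S)

lemma S_one_closed: "\<one>\<^bsub>S\<^esub> \<in> carrier S"
proof -
  have "{a. \<one>\<^bsub>S\<^esub> a \<noteq> \<zero>} \<subseteq> {0}" by auto
  then show ?thesis using finite_subset G_zero by (fastforce simp: in_S simp del: A.one_zeroI)
qed

text \<open>
  Both sides expand to the sum of \<open>f b \<otimes> act b (g (a - b)) \<otimes> act a (h (c - a))\<close> over \<open>a\<close> and \<open>b\<close>;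
  the right-hand side arises with \<open>d = a - b\<close> as the summation variable in place of \<open>a\<close>.
\<close>

lemma S_mult_assoc:
  assumes f: "f \<in> carrier S" and g: "g \<in> carrier S" and h: "h \<in> carrier S"
  shows "(f \<otimes>\<^bsub>S\<^esub> g) \<otimes>\<^bsub>S\<^esub> h = f \<otimes>\<^bsub>S\<^esub> (g \<otimes>\<^bsub>S\<^esub> h)"
proof
  fix c
  note cl = S_apply_closed[OF f] S_apply_closed[OF g] S_apply_closed[OF h]
  note sf = supp_in_S[OF f] and sg = supp_in_S[OF g]
  \<comment> \<open>Cancellation may make the support of the product smaller than the sumset, so both are included.\<close>
  define T where "T = supp (f \<otimes>\<^bsub>S\<^esub> g) \<union> (\<lambda>(a, b). a + b) ` (supp f \<times> supp g)"
  have T: "finite T" "T \<subseteq> G" and sfg: "supp (f \<otimes>\<^bsub>S\<^esub> g) \<subseteq> T"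
    using supp_in_S[OF S_mult_closed[OF f g]] sf sg unfolding T_def by (auto intro!: G_add)
  have T_G: "a \<in> G" if "a \<in> T" for a using T that by blast
  have sf_G: "b \<in> G" if "b \<in> supp f" for b using sf that by blast
  have sg_G: "d \<in> G" if "d \<in> supp g" for d using sg that by blast
  let ?t = "\<lambda>b a. f b \<otimes> (act b (g (a - b)) \<otimes> act a (h (c - a)))"
  have inner: "(\<Oplus>a\<in>T. act b (g (a - b)) \<otimes> act a (h (c - a))) = act b ((g \<otimes>\<^bsub>S\<^esub> h) (c - b))"
    if b: "b \<in> supp f" for b
  proof -
    \<comment> \<open>Only the translate of the support of \<open>g\<close> by \<open>b\<close> contributes.\<close>
    have sub: "(\<lambda>d. b + d) ` supp g \<subseteq> T" using b unfolding T_def by auto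
    have "(\<Oplus>a\<in>T. act b (g (a - b)) \<otimes> act a (h (c - a)))
        = (\<Oplus>a\<in>(\<lambda>d. b + d) ` supp g. act b (g (a - b)) \<otimes> act a (h (c - a)))"
    proof (rule A.add.finprod_mono_neutral_cong_right)
      fix a assume a: "a \<in> T - (\<lambda>d. b + d) ` supp g"
      then have "a - b \<notin> supp g" by (metis DiffD2 add_diff_cancel_left' diff_add_cancel image_eqI add.commute)
      then show "act b (g (a - b)) \<otimes> act a (h (c - a)) = \<zero>"
        using a cl T_G sf_G[OF b] by (auto simp: supp_def)
    qed (use T sub cl T_G sf_G[OF b] in auto)
    also have "\<dots> = (\<Oplus>d\<in>supp g. act b (g d) \<otimes> act (b + d) (h (c - (b + d))))"
      by (subst A.finsum_reindex) (use cl sf_G[OF b] sg_G G_add in \<open>auto simp: inj_on_def\<close>)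
    also have "\<dots> = (\<Oplus>d\<in>supp g. act b (g d \<otimes> act d (h (c - b - d))))"
      by (rule A.finsum_cong')
        (use cl sf_G[OF b] sg_G in \<open>auto simp: act_add act_mult diff_diff_eq\<close>)
    also have "\<dots> = act b (\<Oplus>d\<in>supp g. g d \<otimes> act d (h (c - b - d)))"
      by (rule act_finsum[symmetric]) (use cl sf_G[OF b] sg_G sg in auto)
    also have "(\<Oplus>d\<in>supp g. g d \<otimes> act d (h (c - b - d))) = (g \<otimes>\<^bsub>S\<^esub> h) (c - b)"
      using sg by (intro S_mult[symmetric] g h) auto
    finally show ?thesis .
  qed
  have "((f \<otimes>\<^bsub>S\<^esub> g) \<otimes>\<^bsub>S\<^esub> h) c = (\<Oplus>a\<in>T. (f \<otimes>\<^bsub>S\<^esub> g) a \<otimes> act a (h (c - a)))"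
    by (rule S_mult[OF S_mult_closed[OF f g] h T(1) sfg T(2)])
  also have "\<dots> = (\<Oplus>a\<in>T. \<Oplus>b\<in>supp f. ?t b a)"
  proof (rule A.finsum_cong')
    fix a assume a: "a \<in> T"
    have "(f \<otimes>\<^bsub>S\<^esub> g) a = (\<Oplus>b\<in>supp f. f b \<otimes> act b (g (a - b)))"
      using sf by (intro S_mult f g) auto
    then show "(f \<otimes>\<^bsub>S\<^esub> g) a \<otimes> act a (h (c - a)) = (\<Oplus>b\<in>supp f. ?t b a)"
      using sf a cl T_G sf_G
      by (simp add: A.finsum_ldistr Pi_def) (rule A.finsum_cong', auto simp: A.m_assoc)
  qed (use cl T_G sf_G in \<open>auto intro!: A.finsum_closed\<close>)
  also have "\<dots> = (\<Oplus>b\<in>supp f. \<Oplus>a\<in>T. ?t b a)"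
    using sf T(1) cl T_G sf_G by (intro finsum_swap) auto
  also have "\<dots> = (\<Oplus>b\<in>supp f. f b \<otimes> act b ((g \<otimes>\<^bsub>S\<^esub> h) (c - b)))"
  proof (rule A.finsum_cong')
    fix b assume b: "b \<in> supp f"
    show "(\<Oplus>a\<in>T. ?t b a) = f b \<otimes> act b ((g \<otimes>\<^bsub>S\<^esub> h) (c - b))"
      unfolding inner[OF b, symmetric]
      by (rule A.finsum_rdistr[symmetric]) (use T cl T_G sf_G[OF b] in auto)
  qed (use cl sf_G S_apply_closed[OF S_mult_closed[OF g h]] in auto)
  also have "\<dots> = (f \<otimes>\<^bsub>S\<^esub> (g \<otimes>\<^bsub>S\<^esub> h)) c"
    using sf by (intro S_mult[symmetric] f S_mult_closed g h) auto
  finally show "((f \<otimes>\<^bsub>S\<^esub> g) \<otimes>\<^bsub>S\<^esub> h) c = (f \<otimes>\<^bsub>S\<^esub> (g \<otimes>\<^bsub>S\<^esub> h)) c" .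
qed

lemma ring_S: "ring S"
proof (rule ringI)
  note cl = S_apply_closed
  show "abelian_group S"
  proof (rule abelian_groupI)
    fix f assume f: "f \<in> carrier S"
    show "\<exists>g\<in>carrier S. g \<oplus>\<^bsub>S\<^esub> f = \<zero>\<^bsub>S\<^esub>"
      using S_uminus_closed[OF f] cl[OF f] by (intro bexI[of _ "\<lambda>a. \<ominus> f a"]) (auto simp: A.l_neg)
  qed (auto simp: S_add_closed S_zero_closed cl A.a_ac)
  show "Group.monoid S"
  proof (rule monoidI)
    fix f assume f: "f \<in> carrier S"
    note sf = supp_in_S[OF f]
    show "\<one>\<^bsub>S\<^esub> \<otimes>\<^bsub>S\<^esub> f = f"
    proof
      fix c
      have "(\<one>\<^bsub>S\<^esub> \<otimes>\<^bsub>S\<^esub> f) c = (\<Oplus>a\<in>{0}. \<one>\<^bsub>S\<^esub> a \<otimes> act a (f (c - a)))"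
        by (rule S_mult) (use S_one_closed f G_zero in \<open>auto simp: supp_def\<close>)
      then show "(\<one>\<^bsub>S\<^esub> \<otimes>\<^bsub>S\<^esub> f) c = f c" using cl[OF f] by (simp add: act_0)
    qed
    show "f \<otimes>\<^bsub>S\<^esub> \<one>\<^bsub>S\<^esub> = f"
    proof
      fix c
      have "(f \<otimes>\<^bsub>S\<^esub> \<one>\<^bsub>S\<^esub>) c = (\<Oplus>a\<in>supp f. f a \<otimes> act a (\<one>\<^bsub>S\<^esub> (c - a)))"
        using sf by (intro S_mult f S_one_closed) auto
      also have "\<dots> = (\<Oplus>a\<in>supp f. if c = a then f a else \<zero>)"
        by (rule A.finsum_cong') (use sf cl[OF f] in auto)
      also have "\<dots> = f c"
      proof (cases "c \<in> supp f")
        case True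
        then show ?thesis using sf cl[OF f] by (intro A.finsum_singleton) auto
      next
        case False
        then show ?thesis by (subst A.add.finprod_one_eqI) (auto simp: supp_def)
      qed
      finally show "(f \<otimes>\<^bsub>S\<^esub> \<one>\<^bsub>S\<^esub>) c = f c" .
    qed
  qed (simp_all add: S_mult_closed S_one_closed S_mult_assoc)
  fix f g h assume f: "f \<in> carrier S" and g: "g \<in> carrier S" and h: "h \<in> carrier S"
  note sf = supp_in_S[OF f] and sg = supp_in_S[OF g] and sh = supp_in_S[OF h]
  show "(f \<oplus>\<^bsub>S\<^esub> g) \<otimes>\<^bsub>S\<^esub> h = f \<otimes>\<^bsub>S\<^esub> h \<oplus>\<^bsub>S\<^esub> g \<otimes>\<^bsub>S\<^esub> h"
  proof
    fix c
    let ?T = "supp f \<union> supp g"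
    have T: "finite ?T" "?T \<subseteq> G" using sf sg by auto
    have T_G: "a \<in> G" if "a \<in> ?T" for a using T that by blast
    have "((f \<oplus>\<^bsub>S\<^esub> g) \<otimes>\<^bsub>S\<^esub> h) c = (\<Oplus>a\<in>?T. (f \<oplus>\<^bsub>S\<^esub> g) a \<otimes> act a (h (c - a)))"
      using T by (intro S_mult S_add_closed f g h) (auto simp: supp_def)
    also have "\<dots> = (\<Oplus>a\<in>?T. f a \<otimes> act a (h (c - a)) \<oplus> g a \<otimes> act a (h (c - a)))"
      by (rule A.finsum_cong') (use T_G cl[OF f] cl[OF g] cl[OF h] in \<open>auto simp: A.l_distr\<close>)
    also have "\<dots> = (\<Oplus>a\<in>?T. f a \<otimes> act a (h (c - a))) \<oplus> (\<Oplus>a\<in>?T. g a \<otimes> act a (h (c - a)))"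
      by (rule A.finsum_addf) (use T_G cl[OF f] cl[OF g] cl[OF h] in auto)
    finally show "((f \<oplus>\<^bsub>S\<^esub> g) \<otimes>\<^bsub>S\<^esub> h) c = (f \<otimes>\<^bsub>S\<^esub> h \<oplus>\<^bsub>S\<^esub> g \<otimes>\<^bsub>S\<^esub> h) c"
      using S_mult[OF f h T(1) _ T(2)] S_mult[OF g h T(1) _ T(2)] by simp
  qed
  show "h \<otimes>\<^bsub>S\<^esub> (f \<oplus>\<^bsub>S\<^esub> g) = h \<otimes>\<^bsub>S\<^esub> f \<oplus>\<^bsub>S\<^esub> h \<otimes>\<^bsub>S\<^esub> g"
  proof
    fix c
    have T_G: "a \<in> G" if "a \<in> supp h" for a using sh that by blast
    have "(h \<otimes>\<^bsub>S\<^esub> (f \<oplus>\<^bsub>S\<^esub> g)) c = (\<Oplus>a\<in>supp h. h a \<otimes> act a ((f \<oplus>\<^bsub>S\<^esub> g) (c - a)))"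
      using sh by (intro S_mult S_add_closed f g h) auto
    also have "\<dots> = (\<Oplus>a\<in>supp h. h a \<otimes> act a (f (c - a)) \<oplus> h a \<otimes> act a (g (c - a)))"
      by (rule A.finsum_cong')
        (use T_G cl[OF f] cl[OF g] cl[OF h] in \<open>auto simp: A.r_distr act_plus\<close>)
    also have "\<dots> = (\<Oplus>a\<in>supp h. h a \<otimes> act a (f (c - a))) \<oplus> (\<Oplus>a\<in>supp h. h a \<otimes> act a (g (c - a)))"
      by (rule A.finsum_addf) (use T_G cl[OF f] cl[OF g] cl[OF h] in auto)
    finally show "(h \<otimes>\<^bsub>S\<^esub> (f \<oplus>\<^bsub>S\<^esub> g)) c = (h \<otimes>\<^bsub>S\<^esub> f \<oplus>\<^bsub>S\<^esub> h \<otimes>\<^bsub>S\<^esub> g) c"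
      using S_mult[OF h f, of "supp h"] S_mult[OF h g, of "supp h"] sh by simp
  qed
qed

lemma tensor_closed:
  assumes "x \<in> carrier A" "a \<in> G" shows "smash_tensor A x a \<in> carrier S"
proof -
  have "{b. smash_tensor A x a b \<noteq> \<zero>} \<subseteq> {a}" by (auto simp: smash_tensor_def)
  then show ?thesis using assms finite_subset by (fastforce simp: in_S smash_tensor_def)
qed

lemma tensor_mult:
  assumes "x \<in> carrier A" "a \<in> G" "y \<in> carrier A" "b \<in> G"
  shows "smash_tensor A x a \<otimes>\<^bsub>S\<^esub> smash_tensor A y b = smash_tensor A (x \<otimes> act a y) (a + b)"
proof
  fix c
  have "(smash_tensor A x a \<otimes>\<^bsub>S\<^esub> smash_tensor A y b) c
      = (\<Oplus>d\<in>{a}. smash_tensor A x a d \<otimes> act d (smash_tensor A y b (c - d)))"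
    by (rule S_mult) (use assms tensor_closed in \<open>auto simp: supp_def smash_tensor_def\<close>)
  also have "\<dots> = smash_tensor A (x \<otimes> act a y) (a + b) c"
    using assms by (auto simp: smash_tensor_def)
  finally show "(smash_tensor A x a \<otimes>\<^bsub>S\<^esub> smash_tensor A y b) c = smash_tensor A (x \<otimes> act a y) (a + b) c" .
qed

lemma one_eq_tensor: "\<one>\<^bsub>S\<^esub> = smash_tensor A \<one> 0"
  by (auto simp: smash_tensor_def fun_eq_iff)

lemma tensor_inv:
  assumes "a \<in> G" shows "inv\<^bsub>S\<^esub> (smash_tensor A \<one> a) = smash_tensor A \<one> (- a)"
proof -
  interpret S: ring S by (rule ring_S)
  show ?thesis
    by (rule S.inv_unique'[symmetric])
      (use assms G_uminus in \<open>simp_all add: tensor_closed tensor_mult one_eq_tensor\<close>)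
qed

(* As rewrite rules these would also replace zero and sums in S by lambda abstractions. *)
declare S_simps [simp del]

end

section \<open>Twisted quantum matrix relations\<close>

text \<open>
  Equivalently, \<open>g\<close> is the sum of a function of the row and a function of the column.
\<close>

definition exchange :: "(nat \<times> nat \<Rightarrow> 'g::ab_group_add) \<Rightarrow> bool" where
  "exchange g \<longleftrightarrow> (\<forall>i j s t. g (i, j) + g (s, t) = g (i, t) + g (s, j))"

text \<open>
  In \<open>M\<^sub>q(n)\<close> two generators \<open>x\<close>, \<open>y\<close> that commute up to a scalar satisfy
  \<open>q\<^sup>-\<^sup>e\<^sup>(\<^sup>x\<^sup>,\<^sup>y\<^sup>) x y = q\<^sup>-\<^sup>e\<^sup>(\<^sup>y\<^sup>,\<^sup>x\<^sup>) y x\<close> with \<open>e = ascents\<close>. This puts the relations in a row, in a column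
  and between antidiagonal positions into one form.
\<close>

definition ascents :: "nat \<times> nat \<Rightarrow> nat \<times> nat \<Rightarrow> int" where
  "ascents x y = of_bool (fst x < fst y) + of_bool (snd x < snd y)"

text \<open>
  The quantum matrix relations, with every product \<open>x y\<close> replaced by \<open>q\<^sup>-\<^sup>b\<^sup>(\<^sup>x\<^sup>,\<^sup>y\<^sup>) x y\<close>. They are the
  relations between elements \<open>E\<^sub>x\<close> with \<open>E\<^sub>x E\<^sub>y = q\<^sup>b\<^sup>(\<^sup>x\<^sup>,\<^sup>y\<^sup>) Z\<^sub>x Z\<^sub>y L\<^sup>a\<^sup>(\<^sup>x\<^sup>)\<^sup>+\<^sup>a\<^sup>(\<^sup>y\<^sup>)\<close>.
\<close>

definition twisted_rels ::
    "complex \<Rightarrow> nat \<Rightarrow> (nat \<times> nat \<Rightarrow> nat \<times> nat \<Rightarrow> int) \<Rightarrow> ((nat \<times> nat) ncpoly \<times> (nat \<times> nat) ncpoly) set" where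
  "twisted_rels q n b =
     {((q powi (- ascents (i, j) (s, t) - b (i, j) (s, t))) *\<^sub>C (gx i j * gx s t),
       (q powi (- ascents (s, t) (i, j) - b (s, t) (i, j))) *\<^sub>C (gx s t * gx i j)) | i j s t.
        (i, j) \<in> idx n \<and> (s, t) \<in> idx n \<and> (int s - int i) * (int t - int j) \<le> 0} \<union>
     {((q powi (- b (i, j) (s, t))) *\<^sub>C (gx i j * gx s t),
       (q powi (- b (s, t) (i, j))) *\<^sub>C (gx s t * gx i j)
         + ((q - inverse q) * q powi (- b (i, t) (s, j))) *\<^sub>C (gx i t * gx s j)) | i j s t.
        (i, j) \<in> idx n \<and> (s, t) \<in> idx n \<and> i < s \<and> j < t}"

lemma gx_mult: "gx i j * gx s t = Poly_Mapping.single [(i, j), (s, t)] 1"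
  by (simp add: gen_def mult_single plus_list_def)

text \<open>
  The words that occur together in a relation. They use the same two rows and the same two columns.
\<close>

definition square_words :: "nat \<Rightarrow> nat \<Rightarrow> nat \<Rightarrow> nat \<Rightarrow> (nat \<times> nat) list set" where
  "square_words i j s t = {[(i, j), (s, t)], [(s, t), (i, j)], [(i, t), (s, j)]}"

lemma sum_list_square_words:
  assumes "exchange g" "w \<in> square_words i j s t"
  shows "(\<Sum>x\<leftarrow>w. g x) = g (i, j) + g (s, t)"
  using assms by (auto simp: square_words_def exchange_def add.commute)

lemma wf_twisted_rels: "wf_rels (idx n) (twisted_rels q n b)"
  unfolding wf_rels_def twisted_rels_def
  by (auto intro!: free_alg_closed nc_scale_closed gen_closed simp: idx_def)

lemma twisted_rels_cases [consumes 1, case_names comm diag]: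
  assumes "(l, r) \<in> twisted_rels q n b"
  obtains
    (comm) i j s t where "(i, j) \<in> idx n" "(s, t) \<in> idx n" "(int s - int i) * (int t - int j) \<le> 0"
      "l = (q powi (- ascents (i, j) (s, t) - b (i, j) (s, t))) *\<^sub>C (gx i j * gx s t)"
      "r = (q powi (- ascents (s, t) (i, j) - b (s, t) (i, j))) *\<^sub>C (gx s t * gx i j)"
  | (diag) i j s t where "(i, j) \<in> idx n" "(s, t) \<in> idx n" "i < s" "j < t"
      "l = (q powi (- b (i, j) (s, t))) *\<^sub>C (gx i j * gx s t)"
      "r = (q powi (- b (s, t) (i, j))) *\<^sub>C (gx s t * gx i j)
         + ((q - inverse q) * q powi (- b (i, t) (s, j))) *\<^sub>C (gx i t * gx s j)"
  using assms unfolding twisted_rels_def by blast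

lemma keys_twisted_rels:
  assumes "(l, r) \<in> twisted_rels q n b"
  obtains i j s t where "Poly_Mapping.keys (l - r) \<subseteq> square_words i j s t"
  using assms
proof (cases rule: twisted_rels_cases)
  case (comm i j s t)
  then have "Poly_Mapping.keys (l - r) \<subseteq> square_words i j s t"
    by (auto simp: gx_mult in_keys_iff lookup_minus lookup_single when_def square_words_def split: if_splits)
  then show thesis by (rule that)
next
  case (diag i j s t)
  then have "Poly_Mapping.keys (l - r) \<subseteq> square_words i j s t"
    by (auto simp: gx_mult in_keys_iff lookup_minus lookup_add lookup_single when_def square_words_def
        split: if_splits)
  then show thesis by (rule that)
qed

text \<open>
  The exponent of \<open>q\<close> collected when the Laurent monomials attached to the letters of a word are
  moved to its right end.
\<close>

fun twist :: "('x \<Rightarrow> 'x \<Rightarrow> int) \<Rightarrow> 'x list \<Rightarrow> int" where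
  "twist b [] = 0"
| "twist b (x # w) = (\<Sum>y\<leftarrow>w. b x y) + twist b w"

lemma twist_append: "twist b (u @ v) = twist b u + twist b v + (\<Sum>x\<leftarrow>u. \<Sum>y\<leftarrow>v. b x y)"
  by (induction u) (simp_all add: sum_list_addf algebra_simps)

definition biexchange :: "(nat \<times> nat \<Rightarrow> nat \<times> nat \<Rightarrow> int) \<Rightarrow> bool" where
  "biexchange b \<longleftrightarrow> (\<forall>x. exchange (b x)) \<and> (\<forall>y. exchange (\<lambda>x. b x y))"

text \<open>
  The terms of \<open>twist b (u @ w @ v)\<close> that pair a letter of \<open>w\<close> with a letter of the context are
  sums over \<open>w\<close> of functions with the exchange property, hence the same for the three words.
\<close>

lemma twist_sandwich_square:
  assumes b: "biexchange b"
  shows "\<exists>k. \<forall>w\<in>square_words i j s t. twist b (u @ w @ v) = k + twist b w"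
proof (intro exI ballI)
  fix w assume w: "w \<in> square_words i j s t"
  have right: "exchange (\<lambda>y. b x y)" and left: "exchange (\<lambda>x. \<Sum>y\<leftarrow>v. b x y)" for x
  proof -
    show "exchange (\<lambda>y. b x y)" using b unfolding biexchange_def by blast
    have *: "b (i, j) y + b (s, t) y = b (i, t) y + b (s, j) y" for i j s t y
      using b unfolding biexchange_def exchange_def by blast
    show "exchange (\<lambda>x. \<Sum>y\<leftarrow>v. b x y)"
      unfolding exchange_def by (simp add: sum_list_addf[symmetric] *)
  qed
  show "twist b (u @ w @ v) = (twist b u + twist b v + (\<Sum>x\<leftarrow>u. \<Sum>y\<leftarrow>v. b x y)
      + (\<Sum>x\<leftarrow>u. b x (i, j) + b x (s, t)) + ((\<Sum>y\<leftarrow>v. b (i, j) y) + (\<Sum>y\<leftarrow>v. b (s, t) y))) + twist b w"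
    using sum_list_square_words[OF right w] sum_list_square_words[OF left w]
    by (simp add: twist_append sum_list_addf)
qed

lemma powi_add: "(q::complex) \<noteq> 0 \<Longrightarrow> q powi m * q powi k = q powi (m + k)"
  by (simp add: power_int_add)

lemma powi_coeff:
  "(q::complex) \<noteq> 0 \<Longrightarrow> q powi m * ((q - inverse q) * q powi k) = (q - inverse q) * q powi (m + k)"
  by (simp add: powi_add mult.left_commute[of _ "q - inverse q"])

lemma twisted_comm_mem:
  assumes "q \<noteq> 0" "(i, j) \<in> idx n" "(s, t) \<in> idx n" "(int s - int i) * (int t - int j) \<le> 0"
    and "k - l = ascents (s, t) (i, j) + b (s, t) (i, j) - ascents (i, j) (s, t) - b (i, j) (s, t)"
  shows "(q powi k) *\<^sub>C (gx i j * gx s t) - (q powi l) *\<^sub>C (gx s t * gx i j)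
    \<in> rel_ideal (idx n) (twisted_rels q n b)"
proof -
  let ?e = "\<lambda>x y. - ascents x y - b x y"
  let ?c = "k - ?e (i, j) (s, t)"
  have "(q powi ?e (i, j) (s, t)) *\<^sub>C (gx i j * gx s t) - (q powi ?e (s, t) (i, j)) *\<^sub>C (gx s t * gx i j)
      \<in> rel_ideal (idx n) (twisted_rels q n b)"
    using assms(2-4) by (intro rel_idealI wf_twisted_rels) (unfold twisted_rels_def, blast)
  from rel_ideal_closed(6)[OF wf_twisted_rels this, of "q powi ?c"]
  show ?thesis using assms(1,5) by (simp add: powi_add algebra_simps)
qed

lemma twisted_diag_mem:
  assumes "q \<noteq> 0" "(i, j) \<in> idx n" "(s, t) \<in> idx n" "i < s" "j < t"
    and "k - l = b (s, t) (i, j) - b (i, j) (s, t)" "k - m = b (i, t) (s, j) - b (i, j) (s, t)"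
  shows "(q powi k) *\<^sub>C (gx i j * gx s t) -
     ((q powi l) *\<^sub>C (gx s t * gx i j) + ((q - inverse q) * q powi m) *\<^sub>C (gx i t * gx s j))
    \<in> rel_ideal (idx n) (twisted_rels q n b)"
proof -
  let ?e = "\<lambda>x y. - b x y"
  let ?c = "k + b (i, j) (s, t)"
  have "(q powi ?e (i, j) (s, t)) *\<^sub>C (gx i j * gx s t) - ((q powi ?e (s, t) (i, j)) *\<^sub>C (gx s t * gx i j)
      + ((q - inverse q) * q powi ?e (i, t) (s, j)) *\<^sub>C (gx i t * gx s j))
      \<in> rel_ideal (idx n) (twisted_rels q n b)"
    using assms(2-5) by (intro rel_idealI wf_twisted_rels) (unfold twisted_rels_def, blast)
  moreover have "?c - b (s, t) (i, j) = l" "?c - b (i, t) (s, j) = m" using assms(6,7) by simp_all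
  ultimately show ?thesis
    using rel_ideal_closed(6)[OF wf_twisted_rels, of _ n q b "q powi ?c"] assms(1)
    by (fastforce simp: powi_add powi_coeff)
qed

lemma reweight_twisted_rel:
  assumes q: "q \<noteq> 0" and lr: "(l, r) \<in> twisted_rels q n b"
  shows "reweight (\<lambda>w. q powi (twist b w - twist b' w)) (l - r) \<in> rel_ideal (idx n) (twisted_rels q n b')"
  using lr
proof (cases rule: twisted_rels_cases)
  case (comm i j s t)
  then show ?thesis
    using twisted_comm_mem[OF q comm(1-3), of "- ascents (i, j) (s, t) - b' (i, j) (s, t)"
        "- ascents (s, t) (i, j) - b' (s, t) (i, j)" b'] q
    by (simp add: gx_mult powi_add algebra_simps)
next
  case (diag i j s t)
  then show ?thesis
    using twisted_diag_mem[OF q diag(1-4), of "- b' (i, j) (s, t)" "- b' (s, t) (i, j)" b'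
        "- b' (i, t) (s, j)"] q
    by (simp add: gx_mult powi_add powi_coeff)
qed

text \<open>
  The case \<open>\<delta> = 1\<close> changes the twist from \<open>b\<close> to \<open>b'\<close>; the case \<open>b = b'\<close> with an indicator
  function \<open>\<delta>\<close> says that the ideal is graded by \<open>g\<close>, and with \<open>\<delta> k = q\<^sup>k\<close> that it is stable under
  the action of a Laurent monomial.
\<close>

lemma reweight_twisted:
  assumes q: "q \<noteq> 0" and g: "exchange g" and b: "biexchange b" "biexchange b'"
    and \<chi>: "\<And>w. \<chi> w = \<delta> (\<Sum>x\<leftarrow>w. g x) * q powi (twist b w - twist b' w)"
    and f: "f \<in> rel_ideal (idx n) (twisted_rels q n b)"
  shows "reweight \<chi> f \<in> rel_ideal (idx n) (twisted_rels q n b')"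
  using wf_twisted_rels wf_twisted_rels _ f
proof (rule reweight_rel_ideal)
  fix l r assume lr: "(l, r) \<in> twisted_rels q n b"
  let ?\<psi> = "\<lambda>w. q powi (twist b w - twist b' w)"
  have "\<exists>\<kappa>. \<forall>w\<in>Poly_Mapping.keys (l - r). \<chi> (u @ w @ v) = \<kappa> * ?\<psi> w" for u v
  proof -
    obtain i j s t where keys: "Poly_Mapping.keys (l - r) \<subseteq> square_words i j s t"
      using keys_twisted_rels[OF lr] .
    obtain k where k: "\<forall>w\<in>square_words i j s t. twist b (u @ w @ v) = k + twist b w"
      using twist_sandwich_square[OF b(1)] by blast
    obtain k' where k': "\<forall>w\<in>square_words i j s t. twist b' (u @ w @ v) = k' + twist b' w"
      using twist_sandwich_square[OF b(2)] by blast
    show ?thesis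
    proof (intro exI ballI)
      fix w assume "w \<in> Poly_Mapping.keys (l - r)"
      then have w: "w \<in> square_words i j s t" using keys by blast
      have "(\<Sum>x\<leftarrow>u @ w @ v. g x) = (\<Sum>x\<leftarrow>u. g x) + (g (i, j) + g (s, t)) + (\<Sum>x\<leftarrow>v. g x)"
        using sum_list_square_words[OF g w] by simp
      then show "\<chi> (u @ w @ v) =
          (\<delta> ((\<Sum>x\<leftarrow>u. g x) + (g (i, j) + g (s, t)) + (\<Sum>x\<leftarrow>v. g x)) * q powi (k - k')) * ?\<psi> w"
        unfolding \<chi> using k k' w q by (simp add: powi_add mult.assoc algebra_simps)
    qed
  qed
  then show "\<exists>\<psi>. reweight \<psi> (l - r) \<in> rel_ideal (idx n) (twisted_rels q n b') \<and>
      (\<forall>u v. set u \<subseteq> idx n \<longrightarrow> set v \<subseteq> idx n \<longrightarrow>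
        (\<exists>\<kappa>. \<forall>w\<in>Poly_Mapping.keys (l - r). \<chi> (u @ w @ v) = \<kappa> * \<psi> w))"
    using reweight_twisted_rel[OF q lr] by blast
qed

section \<open>Weights of Laurent monomials and the algebra S\<close>

lemma free_act_eq_reweight: "free_act q a = reweight (\<lambda>w. q powi (\<Sum>x\<leftarrow>w. exp_wt a x))"
  by (simp add: fun_eq_iff free_act_def reweight_def)

lemma exp_wt_superset:
  "finite K \<Longrightarrow> Poly_Mapping.keys a \<subseteq> K \<Longrightarrow>
   exp_wt a x = (\<Sum>v\<in>K. Poly_Mapping.lookup a v * var_wt v x)"
  unfolding exp_wt_def by (rule sum.mono_neutral_left) (auto simp: in_keys_iff)

lemma exp_wt_zero [simp]: "exp_wt 0 x = 0"
  by (simp add: exp_wt_def)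

lemma exp_wt_add: "exp_wt (a + b) x = exp_wt a x + exp_wt b x"
proof -
  let ?K = "Poly_Mapping.keys a \<union> Poly_Mapping.keys b"
  have "exp_wt (a + b) x = (\<Sum>v\<in>?K. Poly_Mapping.lookup (a + b) v * var_wt v x)"
    by (rule exp_wt_superset) (use keys_add[of a b] in auto)
  moreover have "exp_wt a x = (\<Sum>v\<in>?K. Poly_Mapping.lookup a v * var_wt v x)"
    "exp_wt b x = (\<Sum>v\<in>?K. Poly_Mapping.lookup b v * var_wt v x)"
    by (rule exp_wt_superset; auto)+
  ultimately show ?thesis by (simp add: lookup_add distrib_right sum.distrib)
qed

lemma exp_wt_diff: "exp_wt (a - b) x = exp_wt a x - exp_wt b x"
  using exp_wt_add[of "a - b" b x] by simp

lemma exp_wt_uminus: "exp_wt (- a) x = - exp_wt a x"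
  using exp_wt_diff[of 0 a x] by simp

lemma exp_wt_single: "exp_wt (Poly_Mapping.single v c) x = c * var_wt v x"
  using exp_wt_superset[of "{v}" "Poly_Mapping.single v c" x] by simp

lemma exp_wt_sum_list: "exp_wt (\<Sum>x\<leftarrow>w. a x) y = (\<Sum>x\<leftarrow>w. exp_wt (a x) y)"
  by (induction w) (simp_all add: exp_wt_add)

text \<open>
  The weight of each Laurent variable depends on the row alone or on the column alone.
\<close>

lemma exchange_exp_wt: "exchange (exp_wt a)"
proof -
  have "var_wt v (i, j) + var_wt v (s, t) = var_wt v (i, t) + var_wt v (s, j)" for v i j s t
    by (cases v) auto
  then show ?thesis
    unfolding exchange_def exp_wt_def by (simp add: sum.distrib[symmetric] distrib_left[symmetric])
qed

lemma biexchange_exp_wt: "exchange a \<Longrightarrow> biexchange (\<lambda>x. exp_wt (a x))"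
  unfolding biexchange_def
  by (auto simp: exchange_exp_wt) (simp add: exchange_def exp_wt_add[symmetric])

lemma biexchange_zero: "biexchange (\<lambda>_ _. 0)"
  by (simp add: biexchange_def exchange_def)

lemma twist_zero [simp]: "twist (\<lambda>_ _. 0) w = 0"
  by (induction w) simp_all

text \<open>
  The algebra \<open>M\<^sub>q(n)\<close> is used here in the presentation with trivial twist, which generates the
  same ideal as the defining one (\<open>Mq_ideal_eq\<close> below).
\<close>

locale quantum_matrices =
  fixes q :: complex and n :: nat
  assumes q: "q \<noteq> 0"
begin

abbreviation X where "X \<equiv> idx n"
abbreviation R where "R \<equiv> twisted_rels q n (\<lambda>_ _. 0)"
abbreviation M where "M \<equiv> presented_alg X R"
abbreviation G where "G \<equiv> laurent_exps n"

text \<open>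
  The image of the coset \<open>I + f\<close> is all of the coset of the image of \<open>f\<close>, because the action of the
  inverse monomial also preserves the ideal \<open>I\<close>.
\<close>

lemma act_coset:
  assumes f: "f \<in> carrier (free_alg X)"
  shows "Mq_act q a (coset X R f) = coset X R (free_act q a f)"
proof -
  have stable: "free_act q a h \<in> rel_ideal X R" if "h \<in> rel_ideal X R" for h a
    unfolding free_act_eq_reweight
    by (rule reweight_twisted[OF q exchange_exp_wt[of a] biexchange_zero biexchange_zero _ that,
          of _ "\<lambda>k. q powi k"]) simp
  have inverse: "free_act q a (free_act q (- a) h) = h" for h
  proof -
    have "exp_wt (- a) x = - exp_wt a x" for x using exp_wt_add[of a "- a" x] by simp
    then have "(\<Sum>x\<leftarrow>w. exp_wt (- a) x) = - (\<Sum>x\<leftarrow>w. exp_wt a x)" for w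
      by (simp add: uminus_sum_list_map o_def)
    then show ?thesis using q by (simp add: free_act_eq_reweight powi_add reweight_one)
  qed
  show ?thesis
    unfolding Mq_act_def coset_eq_image
  proof (intro equalityI subsetI)
    fix y assume "y \<in> free_act q a ` (\<lambda>h. h + f) ` rel_ideal X R"
    then show "y \<in> (\<lambda>h. h + free_act q a f) ` rel_ideal X R"
      using stable[of _ a] by (auto simp: free_act_eq_reweight)
  next
    fix y assume "y \<in> (\<lambda>h. h + free_act q a f) ` rel_ideal X R"
    then obtain h where h: "h \<in> rel_ideal X R" "y = h + free_act q a f" by blast
    have "y = free_act q a (free_act q (- a) h + f)"
      using inverse[of h] h(2) by (simp add: free_act_eq_reweight)
    then show "y \<in> free_act q a ` (\<lambda>h. h + f) ` rel_ideal X R"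
      using stable[OF h(1), of "- a"] by blast
  qed
qed

lemma free_act_closed: "f \<in> carrier (free_alg X) \<Longrightarrow> free_act q a f \<in> carrier (free_alg X)"
  by (simp add: free_act_eq_reweight reweight_closed)

lemma free_act_hom:
  "free_act q a (f * g) = free_act q a f * free_act q a g"
  "free_act q a (f + g) = free_act q a f + free_act q a g"
  "free_act q a 1 = 1"
proof -
  show "free_act q a (f * g) = free_act q a f * free_act q a g"
    unfolding free_act_eq_reweight by (rule reweight_mult) (simp add: q powi_add)
  show "free_act q a (f + g) = free_act q a f + free_act q a g"
    unfolding free_act_eq_reweight by simp
  show "free_act q a 1 = 1"
    unfolding free_act_eq_reweight single_one[symmetric] reweight_simps by (simp add: zero_list_def)
qed

sublocale smash_data M G "Mq_act q"
proof -
  note wf = wf_twisted_rels[of n q "\<lambda>_ _. 0"]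
  interpret ring M by (rule ring_presented_alg[OF wf])
  show "smash_data M G (Mq_act q)"
  proof
    show "0 \<in> G" by (simp add: laurent_exps_def)
    show "a - b \<in> G" if "a \<in> G" "b \<in> G" for a b
      using that keys_diff[of a b] by (auto simp: laurent_exps_def)
    show "Mq_act q a \<in> ring_hom M M" for a
    proof (rule ring_hom_memI)
      show "Mq_act q a x \<in> carrier M" if "x \<in> carrier M" for x
        using that unfolding carrier_presented_alg by (auto simp: act_coset free_act_closed)
      show "Mq_act q a \<one>\<^bsub>M\<^esub> = \<one>\<^bsub>M\<^esub>"
        by (simp add: coset_one[OF wf] act_coset free_alg_closed free_act_hom)
      fix x y assume "x \<in> carrier M" "y \<in> carrier M"
      then obtain f g where fg: "f \<in> carrier (free_alg X)" "g \<in> carrier (free_alg X)"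
        "x = coset X R f" "y = coset X R g" unfolding carrier_presented_alg by blast
      then show "Mq_act q a (x \<otimes>\<^bsub>M\<^esub> y) = Mq_act q a x \<otimes>\<^bsub>M\<^esub> Mq_act q a y"
        "Mq_act q a (x \<oplus>\<^bsub>M\<^esub> y) = Mq_act q a x \<oplus>\<^bsub>M\<^esub> Mq_act q a y"
        by (simp_all add: coset_hom[OF wf] act_coset free_alg_closed free_act_closed free_act_hom)
    qed
    fix x assume "x \<in> carrier M"
    then obtain f where f: "f \<in> carrier (free_alg X)" "x = coset X R f"
      unfolding carrier_presented_alg by blast
    show "Mq_act q 0 x = x"
      using f by (simp add: act_coset) (simp add: free_act_eq_reweight reweight_one)
    show "Mq_act q (a + b) x = Mq_act q a (Mq_act q b x)" for a b
    proof -
      have "free_act q (a + b) f = free_act q a (free_act q b f)"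
        using q by (simp add: free_act_eq_reweight exp_wt_add sum_list_addf powi_add)
      then show ?thesis using f by (simp add: act_coset free_act_closed)
    qed
  qed
qed

end

section \<open>The subalgebra generated by Z times Laurent monomials\<close>

locale twisted_generators = quantum_matrices +
  fixes a :: "nat \<times> nat \<Rightarrow> lvar \<Rightarrow>\<^sub>0 int"
  assumes a_exchange: "exchange a" and a_closed: "x \<in> idx n \<Longrightarrow> a x \<in> laurent_exps n"
begin

abbreviation b where "b \<equiv> (\<lambda>x. exp_wt (a x))"
abbreviation deg where "deg w \<equiv> (\<Sum>x\<leftarrow>w. a x)"
abbreviation R' where "R' \<equiv> twisted_rels q n b"

lemmas wf = wf_twisted_rels[of n q "\<lambda>_ _. 0"]
lemmas b_biexchange = biexchange_exp_wt[OF a_exchange]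

text \<open>
  Rescaling by the twist, followed by the projection to the words of degree \<open>e\<close>.
\<close>

definition component :: "(lvar \<Rightarrow>\<^sub>0 int) \<Rightarrow> (nat \<times> nat) list \<Rightarrow> complex" where
  "component e w = of_bool (deg w = e) * q powi (twist b w)"

text \<open>
  The homomorphism \<open>x \<mapsto> Z\<^sub>x L\<^sup>a\<^sup>(\<^sup>x\<^sup>)\<close> from the free algebra, in closed form: the coefficient of
  \<open>L\<^sup>e\<close> is read off from the words of degree \<open>e\<close>. This makes linearity and the kernel immediate,
  and leaves multiplicativity to be checked on words.
\<close>

definition \<Phi> :: "(nat \<times> nat) ncpoly \<Rightarrow> S_elt" where
  "\<Phi> f = (\<lambda>e. coset X R (reweight (component e) f))"

lemma deg_closed: "set w \<subseteq> X \<Longrightarrow> deg w \<in> G"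
  by (induction w) (auto simp: G_zero intro!: G_add a_closed)

lemma \<Phi>_closed:
  assumes f: "f \<in> carrier (free_alg X)" shows "\<Phi> f \<in> carrier S"
proof -
  have zero: "\<Phi> f e = \<zero>\<^bsub>M\<^esub>" if "e \<notin> (\<lambda>w. deg w) ` Poly_Mapping.keys f" for e
  proof -
    have "reweight (component e) f = 0"
      by (rule poly_mapping_eqI) (use that in \<open>auto simp: component_def in_keys_iff\<close>)
    then show ?thesis by (simp add: \<Phi>_def coset_zero[OF wf])
  qed
  have "{e. \<Phi> f e \<noteq> \<zero>\<^bsub>M\<^esub>} \<subseteq> (\<lambda>w. deg w) ` Poly_Mapping.keys f" using zero by blast
  then have "finite {e. \<Phi> f e \<noteq> \<zero>\<^bsub>M\<^esub>}" by (rule finite_subset) simp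
  moreover have "\<Phi> f e = \<zero>\<^bsub>M\<^esub>" if "e \<notin> G" for e
    by (rule zero) (use that f deg_closed in \<open>auto simp: in_free_alg\<close>)
  moreover have "\<Phi> f e \<in> carrier M" for e
    by (simp add: \<Phi>_def coset_closed reweight_closed f)
  ultimately show ?thesis by (simp add: in_S)
qed

lemma \<Phi>_add:
  assumes "f \<in> carrier (free_alg X)" "g \<in> carrier (free_alg X)"
  shows "\<Phi> (f + g) = \<Phi> f \<oplus>\<^bsub>S\<^esub> \<Phi> g"
  using assms by (simp add: fun_eq_iff S_simps \<Phi>_def coset_hom[OF wf] reweight_closed)

lemma \<Phi>_scale:
  assumes "f \<in> carrier (free_alg X)"
  shows "\<Phi> (c *\<^sub>C f) = c \<odot>\<^bsub>S\<^esub> \<Phi> f"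
  using assms by (simp add: fun_eq_iff S_simps \<Phi>_def coset_smult[OF wf] reweight_closed)

lemma \<Phi>_single:
  "\<Phi> (Poly_Mapping.single w c)
   = smash_tensor M (coset X R (Poly_Mapping.single w (q powi (twist b w) * c))) (deg w)"
  by (auto simp: fun_eq_iff \<Phi>_def smash_tensor_def component_def coset_zero[OF wf])

lemma \<Phi>_zero: "\<Phi> 0 = \<zero>\<^bsub>S\<^esub>"
  by (simp add: fun_eq_iff S_simps \<Phi>_def coset_zero[OF wf])

text \<open>
  Moving the Laurent monomial of \<open>u\<close> past the word \<open>v\<close> costs exactly the cross term in \<open>twist_append\<close>.
\<close>

lemma \<Phi>_mult_single:
  assumes u: "set u \<subseteq> X" and v: "set v \<subseteq> X"
  shows "\<Phi> (Poly_Mapping.single u c * Poly_Mapping.single v d)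
    = \<Phi> (Poly_Mapping.single u c) \<otimes>\<^bsub>S\<^esub> \<Phi> (Poly_Mapping.single v d)"
proof -
  let ?u = "Poly_Mapping.single u (q powi (twist b u) * c)"
  let ?v = "Poly_Mapping.single v (q powi (twist b v) * d)"
  have in_F: "?u \<in> carrier (free_alg X)" "?v \<in> carrier (free_alg X)"
    using u v by (simp_all add: single_in_free_alg)
  have "(\<Sum>y\<leftarrow>v. exp_wt (deg u) y) = (\<Sum>x\<leftarrow>u. \<Sum>y\<leftarrow>v. b x y)"
    unfolding exp_wt_sum_list by (induction v) (simp_all add: sum_list_addf)
  then have "?u * free_act q (deg u) ?v = Poly_Mapping.single (u @ v) (q powi (twist b (u @ v)) * (c * d))"
    using q by (simp add: free_act_eq_reweight mult_single plus_list_def twist_append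
        power_int_add mult.assoc mult.left_commute)
  moreover have "coset X R ?u \<otimes>\<^bsub>M\<^esub> Mq_act q (deg u) (coset X R ?v) = coset X R (?u * free_act q (deg u) ?v)"
    using in_F by (simp add: act_coset coset_hom[OF wf] free_act_closed)
  ultimately show ?thesis
    using in_F deg_closed[OF u] deg_closed[OF v]
    by (simp add: mult_single plus_list_def \<Phi>_single tensor_mult coset_closed)
qed

lemma \<Phi>_mult:
  assumes f: "f \<in> carrier (free_alg X)" and g: "g \<in> carrier (free_alg X)"
  shows "\<Phi> (f * g) = \<Phi> f \<otimes>\<^bsub>S\<^esub> \<Phi> g"
proof -
  interpret S: ring S by (rule ring_S)
  have single: "\<Phi> (Poly_Mapping.single u c * g) = \<Phi> (Poly_Mapping.single u c) \<otimes>\<^bsub>S\<^esub> \<Phi> g"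
    if u: "set u \<subseteq> X" for u c
    using g
  proof (induction rule: free_alg_induct)
    case zero
    show ?case
      unfolding mult_zero_right \<Phi>_zero
      using u by (intro S.r_null[symmetric] \<Phi>_closed single_in_free_alg)
  next
    case (single_add v d h)
    then show ?case
      using u by (simp add: distrib_left \<Phi>_add free_alg_closed single_in_free_alg \<Phi>_mult_single
          S.r_distr \<Phi>_closed)
  qed
  show ?thesis
    using f
  proof (induction rule: free_alg_induct)
    case zero
    then show ?case using g by (simp add: \<Phi>_zero \<Phi>_closed)
  next
    case (single_add u c h)
    then show ?case
      using g by (simp add: distrib_right \<Phi>_add free_alg_closed single_in_free_alg single
          S.l_distr \<Phi>_closed)
  qed
qed

lemma \<Phi>_one: "\<Phi> 1 = \<one>\<^bsub>S\<^esub>"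
proof -
  have one: "1 = Poly_Mapping.single [] (1 :: complex)"
    unfolding zero_list_def[symmetric] by (rule single_one[symmetric])
  show ?thesis unfolding one \<Phi>_single by (simp add: one[symmetric] one_eq_tensor coset_one[OF wf])
qed

lemma \<Phi>_hom: "\<Phi> \<in> ring_hom (free_alg X) S"
  by (rule ring_hom_memI) (simp_all add: \<Phi>_closed \<Phi>_mult \<Phi>_add \<Phi>_one)

text \<open>
  Components of elements of the twisted ideal lie in the quantum matrix ideal by
  \<open>reweight_twisted\<close>. Conversely, an element is the sum of its untwisted components, and
  untwisting maps the quantum matrix ideal to the twisted one.
\<close>

lemma \<Phi>_kernel:
  assumes f: "f \<in> carrier (free_alg X)"
  shows "\<Phi> f = \<zero>\<^bsub>S\<^esub> \<longleftrightarrow> f \<in> rel_ideal X R'"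
proof -
  have "\<Phi> f = \<zero>\<^bsub>S\<^esub> \<longleftrightarrow> (\<forall>e. reweight (component e) f \<in> rel_ideal X R)"
    by (simp add: fun_eq_iff S_simps \<Phi>_def coset_eq_zero_iff[OF wf] reweight_closed f)
  also have "\<dots> \<longleftrightarrow> f \<in> rel_ideal X R'"
  proof
    assume "f \<in> rel_ideal X R'"
    then have "reweight (component e) f \<in> rel_ideal X R" for e
      by (intro reweight_twisted[OF q a_exchange b_biexchange biexchange_zero,
            where \<delta> = "\<lambda>d. of_bool (d = e)"]) (simp_all add: component_def)
    then show "\<forall>e. reweight (component e) f \<in> rel_ideal X R" ..
  next
    assume components: "\<forall>e. reweight (component e) f \<in> rel_ideal X R"
    \<comment> \<open>On the words of degree \<open>e\<close> this inverts the rescaling in \<open>component e\<close>.\<close>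
    define untwist where "untwist = (\<lambda>w. q powi (- twist b w))"
    have untwist: "reweight untwist h \<in> rel_ideal X R'" if "h \<in> rel_ideal X R" for h
      by (rule reweight_twisted[OF q a_exchange biexchange_zero b_biexchange _ that,
            where \<delta> = "\<lambda>_. 1"]) (simp add: untwist_def)
    define D where "D = (\<lambda>w. deg w) ` Poly_Mapping.keys f"
    have "f = (\<Sum>e\<in>D. reweight untwist (reweight (component e) f))"
    proof (rule poly_mapping_eqI)
      fix w
      have "(\<Sum>e\<in>D. untwist w * component e w * Poly_Mapping.lookup f w)
          = (\<Sum>e\<in>D. if deg w = e then Poly_Mapping.lookup f w else 0)"
        by (rule sum.cong) (use q in \<open>auto simp: untwist_def component_def powi_add\<close>)
      also have "\<dots> = Poly_Mapping.lookup f w"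
        by (auto simp: D_def in_keys_iff)
      finally show "Poly_Mapping.lookup f w =
          Poly_Mapping.lookup (\<Sum>e\<in>D. reweight untwist (reweight (component e) f)) w"
        by (simp add: lookup_sum mult.assoc)
    qed
    moreover have "(\<Sum>e\<in>E. reweight untwist (reweight (component e) f)) \<in> rel_ideal X R'" for E
      using rel_ideal_closed[OF wf_twisted_rels] untwist components
      by (induction E rule: infinite_finite_induct) (simp_all del: reweight_simps(6))
    ultimately show "f \<in> rel_ideal X R'" by metis
  qed
  finally show ?thesis .
qed

theorem twisted_iso:
  "\<exists>\<phi> \<in> alg_iso (presented_alg X R')
      (subalg_gen S ((\<lambda>x. smash_tensor M (presented_gen X R x) (a x)) ` X)).
    \<forall>x\<in>X. \<phi> (presented_gen X R' x) = smash_tensor M (presented_gen X R x) (a x)"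
proof -
  have gen: "\<Phi> (gen x) = smash_tensor M (presented_gen X R x) (a x)" for x
    by (simp add: gen_def \<Phi>_single presented_gen_eq_coset)
  show ?thesis
    using presented_alg_iso_subalg[OF wf_twisted_rels ring_S \<Phi>_hom \<Phi>_scale \<Phi>_kernel]
    by (simp add: image_image gen)
qed

end

section \<open>The four presentations as twists\<close>

text \<open>
  Multiplying a twisted relation by a power of \<open>q\<close> shifts all its exponents equally, so only the
  differences of the exponents have to match.
\<close>

lemma twisted_ideal_subset:
  assumes I: "wf_rels (idx n) R"
    and comm: "\<And>i j s t. (i, j) \<in> idx n \<Longrightarrow> (s, t) \<in> idx n \<Longrightarrow> (int s - int i) * (int t - int j) \<le> 0 \<Longrightarrow>
      \<exists>k l. k - l = ascents (s, t) (i, j) + b (s, t) (i, j) - ascents (i, j) (s, t) - b (i, j) (s, t) \<and>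
        (q powi k) *\<^sub>C (gx i j * gx s t) - (q powi l) *\<^sub>C (gx s t * gx i j) \<in> rel_ideal (idx n) R"
    and diag: "\<And>i j s t. (i, j) \<in> idx n \<Longrightarrow> (s, t) \<in> idx n \<Longrightarrow> i < s \<Longrightarrow> j < t \<Longrightarrow>
      \<exists>k l m. k - l = b (s, t) (i, j) - b (i, j) (s, t) \<and> k - m = b (i, t) (s, j) - b (i, j) (s, t) \<and>
        (q powi k) *\<^sub>C (gx i j * gx s t) -
     ((q powi l) *\<^sub>C (gx s t * gx i j) + ((q - inverse q) * q powi m) *\<^sub>C (gx i t * gx s j))
      \<in> rel_ideal (idx n) R"
    and q: "q \<noteq> 0"
  shows "rel_ideal (idx n) (twisted_rels q n b) \<subseteq> rel_ideal (idx n) R"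
proof (rule rel_ideal_mono[OF wf_twisted_rels I])
  note scale = rel_ideal_closed(6)[OF I]
  fix l r assume "(l, r) \<in> twisted_rels q n b"
  then show "l - r \<in> rel_ideal (idx n) R"
  proof (cases rule: twisted_rels_cases)
    case (comm i j s t)
    obtain k m where *: "k - m = ascents (s, t) (i, j) + b (s, t) (i, j) - ascents (i, j) (s, t) - b (i, j) (s, t)"
        "(q powi k) *\<^sub>C (gx i j * gx s t) - (q powi m) *\<^sub>C (gx s t * gx i j) \<in> rel_ideal (idx n) R"
      using assms(2)[OF comm(1-3)] by blast
    have "- ascents (s, t) (i, j) - b (s, t) (i, j) = - ascents (i, j) (s, t) - b (i, j) (s, t) - k + m"
      using *(1) by simp
    then show ?thesis
      using comm(4,5) scale[OF *(2), of "q powi (- ascents (i, j) (s, t) - b (i, j) (s, t) - k)"] q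
      by (simp add: powi_add)
  next
    case (diag i j s t)
    obtain k m p where *: "k - m = b (s, t) (i, j) - b (i, j) (s, t)" "k - p = b (i, t) (s, j) - b (i, j) (s, t)"
      "(q powi k) *\<^sub>C (gx i j * gx s t) -
     ((q powi m) *\<^sub>C (gx s t * gx i j) + ((q - inverse q) * q powi p) *\<^sub>C (gx i t * gx s j))
      \<in> rel_ideal (idx n) R"
      using assms(3)[OF diag(1-4)] by blast
    have "- b (s, t) (i, j) = - b (i, j) (s, t) - k + m" "- b (i, t) (s, j) = - b (i, j) (s, t) - k + p"
      using *(1,2) by simp_all
    then show ?thesis
      using diag(5,6) scale[OF *(3), of "q powi (- b (i, j) (s, t) - k)"] q
      by (simp add: powi_add powi_coeff)
  qed
qed

text \<open>
  Interchanging the two generators in a relation of the first kind changes it by a sign only, so one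
  order of each pair is enough.
\<close>

lemma twisted_ideal_subset_ordered:
  assumes I: "wf_rels (idx n) R" and q: "q \<noteq> 0"
    and comm: "\<And>i j s t. (i, j) \<in> idx n \<Longrightarrow> (s, t) \<in> idx n \<Longrightarrow> i < s \<and> t \<le> j \<or> i = s \<and> j < t \<Longrightarrow>
      \<exists>k l. k - l = ascents (s, t) (i, j) + b (s, t) (i, j) - ascents (i, j) (s, t) - b (i, j) (s, t) \<and>
        (q powi k) *\<^sub>C (gx i j * gx s t) - (q powi l) *\<^sub>C (gx s t * gx i j) \<in> rel_ideal (idx n) R"
    and diag: "\<And>i j s t. (i, j) \<in> idx n \<Longrightarrow> (s, t) \<in> idx n \<Longrightarrow> i < s \<Longrightarrow> j < t \<Longrightarrow>
      \<exists>k l m. k - l = b (s, t) (i, j) - b (i, j) (s, t) \<and> k - m = b (i, t) (s, j) - b (i, j) (s, t) \<and>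
        (q powi k) *\<^sub>C (gx i j * gx s t) -
     ((q powi l) *\<^sub>C (gx s t * gx i j) + ((q - inverse q) * q powi m) *\<^sub>C (gx i t * gx s j))
      \<in> rel_ideal (idx n) R"
  shows "rel_ideal (idx n) (twisted_rels q n b) \<subseteq> rel_ideal (idx n) R"
proof (rule twisted_ideal_subset[OF I _ diag q])
  fix i j s t
  assume ij: "(i, j) \<in> idx n" and st: "(s, t) \<in> idx n" and "(int s - int i) * (int t - int j) \<le> 0"
  then consider "i = s" "j = t" | "i < s \<and> t \<le> j \<or> i = s \<and> j < t" | "s < i \<and> j \<le> t \<or> s = i \<and> t < j"
    by (cases i s rule: linorder_cases; cases j t rule: linorder_cases) (auto simp: mult_le_0_iff)
  then show "\<exists>k l. k - l = ascents (s, t) (i, j) + b (s, t) (i, j) - ascents (i, j) (s, t) - b (i, j) (s, t) \<and>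
        (q powi k) *\<^sub>C (gx i j * gx s t) - (q powi l) *\<^sub>C (gx s t * gx i j) \<in> rel_ideal (idx n) R"
  proof cases
    case 1
    then show ?thesis using rel_ideal_closed(2)[OF I] by (intro exI[of _ 0]) simp
  next
    case 2
    then show ?thesis by (rule comm[OF ij st])
  next
    case 3
    obtain k l where kl: "k - l = ascents (i, j) (s, t) + b (i, j) (s, t) - ascents (s, t) (i, j) - b (s, t) (i, j)"
      "(q powi k) *\<^sub>C (gx s t * gx i j) - (q powi l) *\<^sub>C (gx i j * gx s t) \<in> rel_ideal (idx n) R"
      using comm[OF st ij 3] by blast
    have "(-1) *\<^sub>C ((q powi k) *\<^sub>C (gx s t * gx i j) - (q powi l) *\<^sub>C (gx i j * gx s t))
        = (q powi l) *\<^sub>C (gx i j * gx s t) - (q powi k) *\<^sub>C (gx s t * gx i j)"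
      by (rule poly_mapping_eqI) (simp add: lookup_minus)
    then show ?thesis
      using rel_ideal_closed(6)[OF I kl(2), of "-1"] kl(1) by (intro exI[of _ l] exI[of _ k]) simp
  qed
qed

lemma wf_Mq_rels: "wf_rels (idx n) (Mq_rels q n)"
  unfolding wf_rels_def Mq_rels_def
  by (auto intro!: free_alg_closed nc_scale_closed gen_closed simp: idx_def)

lemma wf_J0_rels: "wf_rels (idx n) (J0_rels q n)"
  unfolding wf_rels_def J0_rels_def
  by (auto intro!: free_alg_closed nc_scale_closed gen_closed simp: idx_def)

lemma wf_Jz_rels: "wf_rels (idx n) (Jz_rels q n)"
  unfolding wf_rels_def Jz_rels_def
  by (auto intro!: free_alg_closed nc_scale_closed gen_closed simp: idx_def)

lemma wf_Jn_rels: "wf_rels (idx n) (Jn_rels q n)"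
  unfolding wf_rels_def Jn_rels_def
  by (auto intro!: free_alg_closed nc_scale_closed gen_closed simp: idx_def)

lemma Mq_ideal_eq:
  assumes q: "q \<noteq> 0"
  shows "rel_ideal (idx n) (Mq_rels q n) = rel_ideal (idx n) (twisted_rels q n (\<lambda>_ _. 0))"
proof (rule equalityI)
  show "rel_ideal (idx n) (Mq_rels q n) \<subseteq> rel_ideal (idx n) (twisted_rels q n (\<lambda>_ _. 0))"
  proof (rule rel_ideal_mono[OF wf_Mq_rels wf_twisted_rels])
    fix l r assume "(l, r) \<in> Mq_rels q n"
    then consider
      (row) i j k where "i \<in> {1..n}" "j \<in> {1..n}" "k \<in> {1..n}" "j < k"
        "l = gx i j * gx i k" "r = q *\<^sub>C (gx i k * gx i j)"
    | (col) i j k where "i \<in> {1..n}" "j \<in> {1..n}" "k \<in> {1..n}" "i < k"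
        "l = gx i j * gx k j" "r = q *\<^sub>C (gx k j * gx i j)"
    | (anti) i j s t where "(i, j) \<in> idx n" "(s, t) \<in> idx n" "i < s" "t < j"
        "l = gx i j * gx s t" "r = gx s t * gx i j"
    | (diag) i j s t where "(i, j) \<in> idx n" "(s, t) \<in> idx n" "i < s" "j < t"
        "l = gx i j * gx s t" "r = gx s t * gx i j + (q - inverse q) *\<^sub>C (gx i t * gx s j)"
      unfolding Mq_rels_def by blast
    then show "l - r \<in> rel_ideal (idx n) (twisted_rels q n (\<lambda>_ _. 0))"
    proof cases
      case (row i j k)
      then show ?thesis
        using twisted_comm_mem[of q i j n i k 0 1 "\<lambda>_ _. 0"] q by (simp add: ascents_def idx_def)
    next
      case (col i j k)
      then show ?thesis
        using twisted_comm_mem[of q i j n k j 0 1 "\<lambda>_ _. 0"] q by (simp add: ascents_def idx_def)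
    next
      case anti
      then show ?thesis
        using twisted_comm_mem[OF q anti(1,2), of 0 0 "\<lambda>_ _. 0"]
        by (simp add: ascents_def mult_le_0_iff)
    next
      case diag
      then show ?thesis
        using twisted_diag_mem[OF q diag(1-4), of 0 0 "\<lambda>_ _. 0" 0] by simp
    qed
  qed
  note mem = rel_idealI[OF wf_Mq_rels, of _ _ q n]
  show "rel_ideal (idx n) (twisted_rels q n (\<lambda>_ _. 0)) \<subseteq> rel_ideal (idx n) (Mq_rels q n)"
  proof (rule twisted_ideal_subset_ordered[OF wf_Mq_rels q])
    fix i j s t assume ij: "(i, j) \<in> idx n" "(s, t) \<in> idx n"
    then have range: "i \<in> {1..n}" "j \<in> {1..n}" "s \<in> {1..n}" "t \<in> {1..n}" by (simp_all add: idx_def)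
    show "\<exists>k l. k - l = ascents (s, t) (i, j) + 0 - ascents (i, j) (s, t) - 0 \<and>
        (q powi k) *\<^sub>C (gx i j * gx s t) - (q powi l) *\<^sub>C (gx s t * gx i j) \<in> rel_ideal (idx n) (Mq_rels q n)"
      if "i < s \<and> t \<le> j \<or> i = s \<and> j < t"
    proof -
      consider "i = s" "j < t" | "i < s" "j = t" | "i < s" "t < j" using \<open>i < s \<and> t \<le> j \<or> i = s \<and> j < t\<close> by linarith
      then show ?thesis
      proof cases
        case 1
        then have "(gx i j * gx s t, q *\<^sub>C (gx s t * gx i j)) \<in> Mq_rels q n"
          using range unfolding Mq_rels_def by blast
        from mem[OF this] show ?thesis
          using 1 by (intro exI[of _ 0] exI[of _ 1]) (simp add: ascents_def)
      next
        case 2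
        then have "(gx i j * gx s t, q *\<^sub>C (gx s t * gx i j)) \<in> Mq_rels q n"
          using range unfolding Mq_rels_def by blast
        from mem[OF this] show ?thesis
          using 2 by (intro exI[of _ 0] exI[of _ 1]) (simp add: ascents_def)
      next
        case 3
        then have "(gx i j * gx s t, gx s t * gx i j) \<in> Mq_rels q n"
          using ij unfolding Mq_rels_def by blast
        from mem[OF this] show ?thesis
          using 3 by (intro exI[of _ 0]) (simp add: ascents_def)
      qed
    qed
    assume "i < s" "j < t"
    then have "(gx i j * gx s t, gx s t * gx i j + (q - inverse q) *\<^sub>C (gx i t * gx s j)) \<in> Mq_rels q n"
      using ij unfolding Mq_rels_def by blast
    from mem[OF this]
    show "\<exists>k l m. k - l = 0 - 0 \<and> k - m = 0 - 0 \<and>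
        (q powi k) *\<^sub>C (gx i j * gx s t) -
         ((q powi l) *\<^sub>C (gx s t * gx i j) + ((q - inverse q) * q powi m) *\<^sub>C (gx i t * gx s j))
        \<in> rel_ideal (idx n) (Mq_rels q n)"
      by (intro exI[of _ 0]) simp
  qed
qed

text \<open>
  Exponent vectors of \<open>L(\<lambda>\<^sub>\<mu>\<^sub>k)\<close> and \<open>L(\<lambda>\<^sub>\<nu>\<^sub>k)\<close>, with the convention that these are \<open>1\<close> for \<open>k = n\<close>.
\<close>

definition mu_exp :: "nat \<Rightarrow> nat \<Rightarrow> lvar \<Rightarrow>\<^sub>0 int" where
  "mu_exp n k = (if k = n then 0 else Poly_Mapping.single (Mu k) 1)"

definition nu_exp :: "nat \<Rightarrow> nat \<Rightarrow> lvar \<Rightarrow>\<^sub>0 int" where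
  "nu_exp n k = (if k = n then 0 else Poly_Mapping.single (Nu k) 1)"

definition J0_exp :: "nat \<Rightarrow> nat \<times> nat \<Rightarrow> lvar \<Rightarrow>\<^sub>0 int" where
  "J0_exp n = (\<lambda>(i, j). Poly_Mapping.single Beta (- (int i + int j)) - mu_exp n i - nu_exp n j)"

definition Jz_exp :: "nat \<Rightarrow> nat \<times> nat \<Rightarrow> lvar \<Rightarrow>\<^sub>0 int" where
  "Jz_exp n = (\<lambda>(i, j). - mu_exp n i - nu_exp n j)"

definition Jn_exp :: "nat \<Rightarrow> nat \<times> nat \<Rightarrow> lvar \<Rightarrow>\<^sub>0 int" where
  "Jn_exp n = (\<lambda>(i, j). Poly_Mapping.single Beta (- int i + int j) - mu_exp n i + nu_exp n j)"

text \<open>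
  For \<open>i = n\<close> or \<open>j = n\<close> the corresponding indicator is \<open>0\<close>, as \<open>(s, t)\<close> stays within the \<open>n \<times> n\<close> square.
\<close>

lemma exp_wt_exps:
  assumes "(s, t) \<in> idx n"
  shows "exp_wt (J0_exp n (i, j)) (s, t) = - (int i + int j) - of_bool (i < s) - of_bool (j < t)"
    and "exp_wt (Jz_exp n (i, j)) (s, t) = - of_bool (i < s) - of_bool (j < t)"
    and "exp_wt (Jn_exp n (i, j)) (s, t) = int j - int i - of_bool (i < s) + of_bool (j < t)"
  using assms
  by (auto simp: J0_exp_def Jz_exp_def Jn_exp_def mu_exp_def nu_exp_def exp_wt_add exp_wt_diff
      exp_wt_uminus exp_wt_single idx_def)

lemma exchange_exps: "exchange (J0_exp n)" "exchange (Jz_exp n)" "exchange (Jn_exp n)"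
  by (auto simp: exchange_def J0_exp_def Jz_exp_def Jn_exp_def single_add[symmetric]
      add.commute algebra_simps intro!: poly_mapping_eqI)

lemma J0_ideal_eq:
  assumes q: "q \<noteq> 0"
  shows "rel_ideal (idx n) (J0_rels q n) = rel_ideal (idx n) (twisted_rels q n (\<lambda>x. exp_wt (J0_exp n x)))"
    (is "?I = ?J")
proof (rule equalityI)
  show "?I \<subseteq> ?J"
  proof (rule rel_ideal_mono[OF wf_J0_rels wf_twisted_rels])
    fix l r assume "(l, r) \<in> J0_rels q n"
    then consider
      (comm) i j s t where "(i, j) \<in> idx n" "(s, t) \<in> idx n" "(int s - int i) * (int t - int j) \<le> 0"
        "l = gx i j * gx s t" "r = (q powi (int s + int t - int i - int j)) *\<^sub>C (gx s t * gx i j)"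
    | (diag) i j s t where "(i, j) \<in> idx n" "(s, t) \<in> idx n" "i < s" "j < t"
        "l = (q powi (1 - int t + int j)) *\<^sub>C (gx i j * gx s t)"
        "r = (q powi (int s - int i - 1)) *\<^sub>C (gx s t * gx i j) + (q - inverse q) *\<^sub>C (gx i t * gx s j)"
      unfolding J0_rels_def by blast
    then show "l - r \<in> ?J"
    proof cases
      case (comm i j s t)
      then show ?thesis
        using twisted_comm_mem[OF q comm(1-3), of 0 "int s + int t - int i - int j" "\<lambda>x. exp_wt (J0_exp n x)"]
        by (simp add: ascents_def exp_wt_exps)
    next
      case (diag i j s t)
      then have "(s, j) \<in> idx n" by (simp add: idx_def)
      then show ?thesis
        using diag twisted_diag_mem[OF q diag(1-4), of "1 - int t + int j" "int s - int i - 1"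
            "\<lambda>x. exp_wt (J0_exp n x)" 0]
        by (simp add: exp_wt_exps)
    qed
  qed
  note mem = rel_idealI[OF wf_J0_rels, of _ _ q n]
  show "?J \<subseteq> ?I"
  proof (rule twisted_ideal_subset_ordered[OF wf_J0_rels q])
    fix i j s t assume ij: "(i, j) \<in> idx n" "(s, t) \<in> idx n"
    then have sj: "(s, j) \<in> idx n" by (simp add: idx_def)
    show "\<exists>k l. k - l = ascents (s, t) (i, j) + exp_wt (J0_exp n (s, t)) (i, j)
          - ascents (i, j) (s, t) - exp_wt (J0_exp n (i, j)) (s, t) \<and>
        (q powi k) *\<^sub>C (gx i j * gx s t) - (q powi l) *\<^sub>C (gx s t * gx i j) \<in> ?I"
      if order: "i < s \<and> t \<le> j \<or> i = s \<and> j < t"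
    proof -
      have "(int s - int i) * (int t - int j) \<le> 0" using order by (auto simp: mult_le_0_iff)
      then have "(gx i j * gx s t, (q powi (int s + int t - int i - int j)) *\<^sub>C (gx s t * gx i j)) \<in> J0_rels q n"
        using ij unfolding J0_rels_def by blast
      from mem[OF this] show ?thesis
        using ij order
        by (intro exI[of _ 0] exI[of _ "int s + int t - int i - int j"]) (auto simp: ascents_def exp_wt_exps)
    qed
    assume st: "i < s" "j < t"
    then have "((q powi (1 - int t + int j)) *\<^sub>C (gx i j * gx s t),
        (q powi (int s - int i - 1)) *\<^sub>C (gx s t * gx i j) + (q - inverse q) *\<^sub>C (gx i t * gx s j)) \<in> J0_rels q n"
      using ij unfolding J0_rels_def by blast
    from mem[OF this]
    show "\<exists>k l m. k - l = exp_wt (J0_exp n (s, t)) (i, j) - exp_wt (J0_exp n (i, j)) (s, t) \<and>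
        k - m = exp_wt (J0_exp n (i, t)) (s, j) - exp_wt (J0_exp n (i, j)) (s, t) \<and>
        (q powi k) *\<^sub>C (gx i j * gx s t) -
         ((q powi l) *\<^sub>C (gx s t * gx i j) + ((q - inverse q) * q powi m) *\<^sub>C (gx i t * gx s j)) \<in> ?I"
      using ij sj st
      by (intro exI[of _ "1 - int t + int j"] exI[of _ "int s - int i - 1"] exI[of _ 0])
        (simp add: exp_wt_exps)
  qed
qed

lemma Jz_ideal_eq:
  assumes q: "q \<noteq> 0"
  shows "rel_ideal (idx n) (Jz_rels q n) = rel_ideal (idx n) (twisted_rels q n (\<lambda>x. exp_wt (Jz_exp n x)))"
    (is "?I = ?J")
proof (rule equalityI)
  show "?I \<subseteq> ?J"
  proof (rule rel_ideal_mono[OF wf_Jz_rels wf_twisted_rels])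
    fix l r assume "(l, r) \<in> Jz_rels q n"
    then consider
      (comm) i j s t where "(i, j) \<in> idx n" "(s, t) \<in> idx n" "(int s - int i) * (int t - int j) \<le> 0"
        "l = gx i j * gx s t" "r = gx s t * gx i j"
    | (diag) i j s t where "(i, j) \<in> idx n" "(s, t) \<in> idx n" "i < s" "j < t"
        "l = q *\<^sub>C (gx i j * gx s t)"
        "r = inverse q *\<^sub>C (gx s t * gx i j) + (q - inverse q) *\<^sub>C (gx i t * gx s j)"
      unfolding Jz_rels_def by blast
    then show "l - r \<in> ?J"
    proof cases
      case (comm i j s t)
      then show ?thesis
        using twisted_comm_mem[OF q comm(1-3), of 0 0 "\<lambda>x. exp_wt (Jz_exp n x)"]
        by (simp add: ascents_def exp_wt_exps)
    next
      case (diag i j s t)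
      then have "(s, j) \<in> idx n" by (simp add: idx_def)
      then show ?thesis
        using diag twisted_diag_mem[OF q diag(1-4), of 1 "-1" "\<lambda>x. exp_wt (Jz_exp n x)" 0]
        by (simp add: exp_wt_exps power_int_minus)
    qed
  qed
  note mem = rel_idealI[OF wf_Jz_rels, of _ _ q n]
  show "?J \<subseteq> ?I"
  proof (rule twisted_ideal_subset_ordered[OF wf_Jz_rels q])
    fix i j s t assume ij: "(i, j) \<in> idx n" "(s, t) \<in> idx n"
    then have sj: "(s, j) \<in> idx n" by (simp add: idx_def)
    show "\<exists>k l. k - l = ascents (s, t) (i, j) + exp_wt (Jz_exp n (s, t)) (i, j)
          - ascents (i, j) (s, t) - exp_wt (Jz_exp n (i, j)) (s, t) \<and>
        (q powi k) *\<^sub>C (gx i j * gx s t) - (q powi l) *\<^sub>C (gx s t * gx i j) \<in> ?I"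
      if order: "i < s \<and> t \<le> j \<or> i = s \<and> j < t"
    proof -
      have "(int s - int i) * (int t - int j) \<le> 0" using order by (auto simp: mult_le_0_iff)
      then have "(gx i j * gx s t, gx s t * gx i j) \<in> Jz_rels q n"
        using ij unfolding Jz_rels_def by blast
      from mem[OF this] show ?thesis
        using ij order by (intro exI[of _ 0]) (auto simp: ascents_def exp_wt_exps)
    qed
    assume st: "i < s" "j < t"
    then have "(q *\<^sub>C (gx i j * gx s t),
        inverse q *\<^sub>C (gx s t * gx i j) + (q - inverse q) *\<^sub>C (gx i t * gx s j)) \<in> Jz_rels q n"
      using ij unfolding Jz_rels_def by blast
    from mem[OF this]
    show "\<exists>k l m. k - l = exp_wt (Jz_exp n (s, t)) (i, j) - exp_wt (Jz_exp n (i, j)) (s, t) \<and>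
        k - m = exp_wt (Jz_exp n (i, t)) (s, j) - exp_wt (Jz_exp n (i, j)) (s, t) \<and>
        (q powi k) *\<^sub>C (gx i j * gx s t) -
         ((q powi l) *\<^sub>C (gx s t * gx i j) + ((q - inverse q) * q powi m) *\<^sub>C (gx i t * gx s j)) \<in> ?I"
      using ij sj st
      by (intro exI[of _ 1] exI[of _ "-1"] exI[of _ 0]) (simp add: exp_wt_exps power_int_minus)
  qed
qed

text \<open>
  The defining relations within a row are stated for \<open>t < j\<close>, the opposite of the order chosen in
  \<open>twisted_ideal_subset_ordered\<close>; that case uses the negative of a defining relation.
\<close>

lemma Jn_ideal_eq:
  assumes q: "q \<noteq> 0"
  shows "rel_ideal (idx n) (Jn_rels q n) = rel_ideal (idx n) (twisted_rels q n (\<lambda>x. exp_wt (Jn_exp n x)))"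
    (is "?I = ?J")
proof (rule equalityI)
  show "?I \<subseteq> ?J"
  proof (rule rel_ideal_mono[OF wf_Jn_rels wf_twisted_rels])
    fix l r assume "(l, r) \<in> Jn_rels q n"
    then consider
      (left) i j s t where "(i, j) \<in> idx n" "(s, t) \<in> idx n" "i \<le> s" "t < j"
        "l = gx i j * gx s t" "r = (q powi (int s - int t - int i + int j - 2)) *\<^sub>C (gx s t * gx i j)"
    | (col) i j s t where "(i, j) \<in> idx n" "(s, t) \<in> idx n" "i < s" "t = j"
        "l = gx i j * gx s t" "r = (q powi (int s - int i)) *\<^sub>C (gx s t * gx i j)"
    | (diag) i j s t where "(i, j) \<in> idx n" "(s, t) \<in> idx n" "i < s" "j < t"
        "l = (q powi (int t - int j - 1)) *\<^sub>C (gx i j * gx s t)"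
        "r = (q powi (int s - int i - 1)) *\<^sub>C (gx s t * gx i j) + (q - inverse q) *\<^sub>C (gx i t * gx s j)"
      unfolding Jn_rels_def by blast
    then show "l - r \<in> ?J"
    proof cases
      case (left i j s t)
      then have le: "(int s - int i) * (int t - int j) \<le> 0" by (simp add: mult_le_0_iff)
      show ?thesis
        using left twisted_comm_mem[OF q left(1,2) le, of 0 "int s - int t - int i + int j - 2"
            "\<lambda>x. exp_wt (Jn_exp n x)"]
        by (simp add: ascents_def exp_wt_exps)
    next
      case (col i j s t)
      then show ?thesis
        using twisted_comm_mem[OF q col(1,2), of 0 "int s - int i" "\<lambda>x. exp_wt (Jn_exp n x)"]
        by (simp add: ascents_def exp_wt_exps)
    next
      case (diag i j s t)
      then have "(s, j) \<in> idx n" by (simp add: idx_def)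
      then show ?thesis
        using diag twisted_diag_mem[OF q diag(1-4), of "int t - int j - 1" "int s - int i - 1"
            "\<lambda>x. exp_wt (Jn_exp n x)" 0]
        by (simp add: exp_wt_exps)
    qed
  qed
  note mem = rel_idealI[OF wf_Jn_rels, of _ _ q n]
  show "?J \<subseteq> ?I"
  proof (rule twisted_ideal_subset_ordered[OF wf_Jn_rels q])
    fix i j s t assume ij: "(i, j) \<in> idx n" "(s, t) \<in> idx n"
    then have sj: "(s, j) \<in> idx n" by (simp add: idx_def)
    show "\<exists>k l. k - l = ascents (s, t) (i, j) + exp_wt (Jn_exp n (s, t)) (i, j)
          - ascents (i, j) (s, t) - exp_wt (Jn_exp n (i, j)) (s, t) \<and>
        (q powi k) *\<^sub>C (gx i j * gx s t) - (q powi l) *\<^sub>C (gx s t * gx i j) \<in> ?I"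
      if order: "i < s \<and> t \<le> j \<or> i = s \<and> j < t"
    proof -
      consider "i < s" "t < j" | "i < s" "t = j" | "i = s" "j < t" using order by linarith
      then show ?thesis
      proof cases
        case 1
        then have "(gx i j * gx s t, (q powi (int s - int t - int i + int j - 2)) *\<^sub>C (gx s t * gx i j)) \<in> Jn_rels q n"
          using ij less_imp_le[OF 1(1)] unfolding Jn_rels_def by blast
        from mem[OF this] show ?thesis
          using ij 1
          by (intro exI[of _ 0] exI[of _ "int s - int t - int i + int j - 2"])
            (simp add: ascents_def exp_wt_exps)
      next
        case 2
        then have "(gx i j * gx s t, (q powi (int s - int i)) *\<^sub>C (gx s t * gx i j)) \<in> Jn_rels q n"
          using ij unfolding Jn_rels_def by blast
        from mem[OF this] show ?thesis
          using ij 2 by (intro exI[of _ 0] exI[of _ "int s - int i"]) (simp add: ascents_def exp_wt_exps)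
      next
        case 3
        then have "(gx s t * gx i j, (q powi (int i - int j - int s + int t - 2)) *\<^sub>C (gx i j * gx s t)) \<in> Jn_rels q n"
          using ij unfolding Jn_rels_def by blast
        from rel_ideal_closed(6)[OF wf_Jn_rels mem[OF this], of "-1"]
        have "(q powi (int t - int j - 2)) *\<^sub>C (gx i j * gx s t) - (q powi 0) *\<^sub>C (gx s t * gx i j) \<in> ?I"
          using 3 by (simp add: single_uminus algebra_simps gx_mult)
        then show ?thesis
          using ij 3 by (intro exI[of _ "int t - int j - 2"] exI[of _ 0] conjI)
            (simp_all add: ascents_def exp_wt_exps)
      qed
    qed
    assume st: "i < s" "j < t"
    then have "((q powi (int t - int j - 1)) *\<^sub>C (gx i j * gx s t),
        (q powi (int s - int i - 1)) *\<^sub>C (gx s t * gx i j) + (q - inverse q) *\<^sub>C (gx i t * gx s j)) \<in> Jn_rels q n"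
      using ij unfolding Jn_rels_def by blast
    from mem[OF this]
    show "\<exists>k l m. k - l = exp_wt (Jn_exp n (s, t)) (i, j) - exp_wt (Jn_exp n (i, j)) (s, t) \<and>
        k - m = exp_wt (Jn_exp n (i, t)) (s, j) - exp_wt (Jn_exp n (i, j)) (s, t) \<and>
        (q powi k) *\<^sub>C (gx i j * gx s t) -
         ((q powi l) *\<^sub>C (gx s t * gx i j) + ((q - inverse q) * q powi m) *\<^sub>C (gx i t * gx s j)) \<in> ?I"
      using ij sj st
      by (intro exI[of _ "int t - int j - 1"] exI[of _ "int s - int i - 1"] exI[of _ 0])
        (simp add: exp_wt_exps)
  qed
qed

section \<open>The generators J, M and N in S\<close>

context quantum_matrices
begin

lemma Mq_eq: "Mq q n = M" and Mq_gen_eq: "presented_gen X (Mq_rels q n) = presented_gen X R"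
  unfolding Mq_def by (rule presented_alg_cong[OF Mq_ideal_eq[OF q]])+

lemma S_alg_eq: "S_alg q n = S"
  by (simp add: S_alg_def Mq_eq)

abbreviation L where "L e \<equiv> smash_tensor M \<one>\<^bsub>M\<^esub> e"

lemma tensor_mult_L:
  "x \<in> carrier M \<Longrightarrow> e \<in> G \<Longrightarrow> e' \<in> G \<Longrightarrow> smash_tensor M x e \<otimes>\<^bsub>S\<^esub> L e' = smash_tensor M x (e + e')"
  by (simp add: tensor_mult)

lemma Beta_closed: "Poly_Mapping.single Beta c \<in> G"
  by (simp add: laurent_exps_def lvars_def)

lemma mu_closed: "k \<in> {1..n} \<Longrightarrow> mu_exp n k \<in> G"
  and nu_closed: "k \<in> {1..n} \<Longrightarrow> nu_exp n k \<in> G"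
  by (auto simp: mu_exp_def nu_exp_def laurent_exps_def lvars_def)

lemma L_beta_int_pow: "L_beta q n [^]\<^bsub>S\<^esub> (c :: int) = L (Poly_Mapping.single Beta c)"
proof -
  have nat: "L (Poly_Mapping.single Beta 1) [^]\<^bsub>S\<^esub> m = L (Poly_Mapping.single Beta (int m))" for m :: nat
    by (induction m) (simp_all add: one_eq_tensor tensor_mult_L Beta_closed single_add[symmetric] add.commute)
  show ?thesis
    by (simp add: L_beta_def L_elt_def Mq_eq int_pow_def2 nat tensor_inv Beta_closed single_uminus[symmetric])
qed

lemma L_mu_eq: "L_mu q n k = L (mu_exp n k)" and L_nu_eq: "L_nu q n k = L (nu_exp n k)"
  by (simp_all add: L_mu_def L_nu_def L_elt_def mu_exp_def nu_exp_def S_alg_eq Mq_eq one_eq_tensor)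

lemma Z_elt_eq: "Z_elt q n i j = smash_tensor M (presented_gen X R (i, j)) 0"
  by (simp add: Z_elt_def Mq_eq Mq_gen_eq)

lemma generator_elts:
  assumes "x \<in> X"
  shows "J_elt q n x = smash_tensor M (presented_gen X R x) (J0_exp n x)"
    and "M_elt q n x = smash_tensor M (presented_gen X R x) (Jz_exp n x)"
    and "N_elt q n x = smash_tensor M (presented_gen X R x) (Jn_exp n x)"
proof -
  obtain i j where x: "x = (i, j)" and ij: "i \<in> {1..n}" "j \<in> {1..n}"
    using assms by (auto simp: idx_def)
  have gen: "presented_gen X R (i, j) \<in> carrier M"
    using assms unfolding x presented_gen_eq_coset by (intro coset_closed gen_closed)
  note simps = S_alg_eq Z_elt_eq L_beta_int_pow L_mu_eq L_nu_eq tensor_inv tensor_mult_L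
    gen Beta_closed mu_closed nu_closed ij G_uminus G_add G_zero
  show "J_elt q n x = smash_tensor M (presented_gen X R x) (J0_exp n x)"
    unfolding x J_elt_def prod.case by (simp only: simps) (simp add: J0_exp_def)
  show "M_elt q n x = smash_tensor M (presented_gen X R x) (Jz_exp n x)"
    unfolding x M_elt_def prod.case by (simp only: simps) (simp add: Jz_exp_def)
  show "N_elt q n x = smash_tensor M (presented_gen X R x) (Jn_exp n x)"
    unfolding x N_elt_def prod.case by (simp only: simps) (simp add: Jn_exp_def)
qed

lemma exps_closed:
  assumes "x \<in> X" shows "J0_exp n x \<in> G" "Jz_exp n x \<in> G" "Jn_exp n x \<in> G"
  using assms
  by (auto simp: J0_exp_def Jz_exp_def Jn_exp_def idx_def
      intro!: G_diff G_add G_uminus Beta_closed mu_closed nu_closed)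

lemma iso_subalg:
  assumes a: "exchange a" "\<And>x. x \<in> X \<Longrightarrow> a x \<in> G"
    and ideal: "rel_ideal X Q = rel_ideal X (twisted_rels q n (\<lambda>x. exp_wt (a x)))"
    and E: "\<And>x. x \<in> X \<Longrightarrow> E x = smash_tensor M (presented_gen X R x) (a x)"
  shows "\<exists>\<phi> \<in> alg_iso (presented_alg X Q) (subalg_gen (S_alg q n) (E ` X)).
    \<forall>x\<in>X. \<phi> (presented_gen X Q x) = E x"
proof -
  interpret twisted_generators q n a
    by unfold_locales (use a in auto)
  have "E ` X = (\<lambda>x. smash_tensor M (presented_gen X R x) (a x)) ` X"
    using E by (rule image_cong[OF refl])
  then show ?thesis
    using twisted_iso E by (simp add: presented_alg_cong[OF ideal] S_alg_eq)
qed

end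

theorem proposition7p2:
  fixes q :: complex and n :: nat
  assumes "q \<noteq> 0" and "q\<^sup>2 \<noteq> 1" and "n \<ge> 1"
  shows "(\<exists>\<phi> \<in> alg_iso (J0 q n) (subalg_gen (S_alg q n) (J_elt q n ` idx n)).
            \<forall>x \<in> idx n. \<phi> (presented_gen (idx n) (J0_rels q n) x) = J_elt q n x)
       \<and> (\<exists>\<phi> \<in> alg_iso (Jz q n) (subalg_gen (S_alg q n) (M_elt q n ` idx n)).
            \<forall>x \<in> idx n. \<phi> (presented_gen (idx n) (Jz_rels q n) x) = M_elt q n x)
       \<and> (\<exists>\<phi> \<in> alg_iso (Jn q n) (subalg_gen (S_alg q n) (N_elt q n ` idx n)).
            \<forall>x \<in> idx n. \<phi> (presented_gen (idx n) (Jn_rels q n) x) = N_elt q n x)"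
proof -
  interpret quantum_matrices q n by unfold_locales (fact assms(1))
  show ?thesis
    unfolding J0_def Jz_def Jn_def
    using iso_subalg[OF exchange_exps(1) exps_closed(1) J0_ideal_eq[OF assms(1)] generator_elts(1)]
      iso_subalg[OF exchange_exps(2) exps_closed(2) Jz_ideal_eq[OF assms(1)] generator_elts(2)]
      iso_subalg[OF exchange_exps(3) exps_closed(3) Jn_ideal_eq[OF assms(1)] generator_elts(3)]
    by blast
qed

end
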